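(* Let $w_1,w_2$ be classical scalar weights of the same type (both shifted Hermite, both Laguerre, or both Jacobi). Then the right $\mathcal D(w_2)$-module $\mathcal D(w_1,w_2)$ is cyclic: there exists a differential operator $\mathcal T=\mathcal T_{w_1,w_2}\in\Omega[x]$ such that $$\mathcal D(w_1,w_2)=\mathcal T\cdot\mathcal D(w_2).$$ Moreover, $\mathcal T_{w_1,w_2}$ is given as follows. (i) If $w_1$ is not a Darboux transformation of $w_2$, then $\mathcal T=0$. (ii) If $w_1=w_2$, then $\mathcal T=1$. (iii) For Laguerre weights $w_\alpha$ ($\alpha>-1$) and $k\in\mathbb N$, $$\mathcal T_{w_\alpha,w_{\alpha+k}}=(\partial-1)^k,\qquad \mathcal T_{w_{\alpha+k},w_\alpha}=\mathcal N_k\mathcal N_{k-1}\cdots\mathcal N_1,\quad \mathcal N_j=\partial x+\alpha+j.$$ (iv) For Jacobi weights $w_{\alpha,\beta}$ ($\alpha,\beta>-1$) and $k\in\mathbb N$, $$\mathcal T_{w_{\alpha,\beta+k},w_{\alpha+k,\beta}}=\mathcal V_k\mathcal V_{k-1}\cdots\mathcal V_1,\quad \mathcal V_j=\partial(1+x)+\beta+j,$$ $$\mathcal T_{w_{\alpha+k,\beta},w_{\alpha,\beta+k}}=\mathcal M_k\mathcal M_{k-1}\cdots\mathcal M_1,\quad \mathcal M_j=\partial(x-1)+\alpha+j.$$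
   Context: Classical scalar weights: shifted Hermite $w_b(x)=e^{-x^2+2bx}$ on $(-\infty,\infty)$, $b\in\mathbb R$; Laguerre $w_\alpha(x)=e^{-x}x^\alpha$ on $(0,\infty)$, $\alpha>-1$; Jacobi $w_{\alpha,\beta}(x)=(1-x)^\alpha(1+x)^\beta$ on $(-1,1)$, $\alpha,\beta>-1$. Differential operators $D=\sum_{j}\partial^jf_j(x)$ with $f_j\in\mathbb C[x]$, $\partial=\frac{d}{dx}$, act on the right on functions: $p(x)\cdot D=\sum_j p^{(j)}(x)f_j(x)$ (so $p\cdot(\partial x)=p'(x)\,x$); products satisfy $p\cdot(D_1D_2)=(p\cdot D_1)\cdot D_2$. The algebra of these operators is denoted $\Omega[x]$. For scalar weights $w_1,w_2$ with monic orthogonal polynomials $p_n^{w_1},p_n^{w_2}$, $$\mathcal D(w_1,w_2)=\{\mathcal T\in\Omega[x] : p_n^{w_1}\cdot\mathcal T=\Lambda_n(\mathcal T)p_n^{w_2},\ \Lambda_n(\mathcal T)\in\mathbb C,\ \text{for all } n\ge0\},$$ and $\mathcal D(w)=\mathcal D(w,w)$, which is an algebra; $\mathcal D(w_1,w_2)$ is a right $\mathcal D(w_2)$-module. An operator $\mathcal V\in\Omega[x]$ is degree-preserving if $\deg(p\cdot\mathcal V)=\deg p$ for all $p\in\mathbb C[x]$. For scalar weights $w,\widetilde w$ on the same interval with monic orthogonal polynomials $p_n,\widetilde p_n$, $\widetilde w$ is a Darboux transformation of $w$ if there is $D\in\mathcal D(w)$ with $D=\mathcal V\mathcal N$, where $\mathcal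 V,\mathcal N\in\Omega[x]$ are degree-preserving and $p_n\cdot\mathcal V=A_n\widetilde p_n$ for all $n\in\mathbb N_0$, for some $A_n\in\mathbb C$. *)

theory Defs
  imports "HOL-Analysis.Analysis" "HOL-Computational_Algebra.Computational_Algebra"
begin

section \<open>The algebra of differential operators with polynomial coefficients\<close>

text \<open>
  The operator \<open>D = \<Sum>\<^sub>j \<partial>\<^sup>j f\<^sub>j(x)\<close> is represented by its coefficient sequence
  \<open>f\<^sub>0, f\<^sub>1, \<dots>\<close>, i.e. by a polynomial in \<open>\<partial>\<close> with coefficients (written on the right) in
  \<open>\<complex>[x]\<close>.
\<close>

typedef diff_op = "UNIV :: complex poly poly set"
  morphisms op_coeffs Diff_Op ..

definition raw_act :: "complex poly \<Rightarrow> complex poly poly \<Rightarrow> complex poly" where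
  "raw_act p F = (\<Sum>j\<le>degree F. (pderiv ^^ j) p * coeff F j)"

definition act :: "complex poly \<Rightarrow> diff_op \<Rightarrow> complex poly"  (infixl "\<cdot>" 70) where
  "p \<cdot> D = raw_act p (op_coeffs D)"

text \<open>
  Right multiplication by \<open>\<partial>\<close>: since \<open>f \<partial> = \<partial> f + f'\<close> for operators acting on the right,
  \<open>(\<Sum>\<^sub>j \<partial>\<^sup>j f\<^sub>j) \<partial> = \<Sum>\<^sub>j \<partial>\<^sup>j\<^sup>+\<^sup>1 f\<^sub>j + \<Sum>\<^sub>j \<partial>\<^sup>j f\<^sub>j'\<close>.  The product with \<open>\<Sum>\<^sub>j \<partial>\<^sup>j g\<^sub>j\<close> is obtained from this.
  Lemma \<open>act_times\<close> below confirms that the product is composition of right actions, and lemma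
  \<open>diff_op_eqI\<close> that the action is faithful.
\<close>

definition raw_times_partial :: "complex poly poly \<Rightarrow> complex poly poly" where
  "raw_times_partial F = pCons 0 F + map_poly pderiv F"

definition raw_times :: "complex poly poly \<Rightarrow> complex poly poly \<Rightarrow> complex poly poly" where
  "raw_times F G = (\<Sum>j\<le>degree G. smult (coeff G j) ((raw_times_partial ^^ j) F))"

lemma raw_act_bound:
  assumes "degree F \<le> N"
  shows "raw_act p F = (\<Sum>j\<le>N. (pderiv ^^ j) p * coeff F j)"
  unfolding raw_act_def
  by (rule sum.mono_neutral_left) (use assms in \<open>auto simp: coeff_eq_0\<close>)

lemma raw_act_0 [simp]: "raw_act p 0 = 0"
  by (simp add: raw_act_def)

lemma raw_act_1 [simp]: "raw_act p 1 = p"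
  by (simp add: raw_act_def)

lemma raw_act_add: "raw_act p (F + G) = raw_act p F + raw_act p G"
proof -
  define N where "N = max (degree F) (degree G)"
  have "degree (F + G) \<le> N" "degree F \<le> N" "degree G \<le> N"
    by (auto simp: N_def degree_add_le_max)
  thus ?thesis
    by (simp add: raw_act_bound[where N = N] sum.distrib algebra_simps)
qed

lemma raw_act_uminus: "raw_act p (- F) = - raw_act p F"
  using raw_act_add[of p "- F" F] by (simp add: eq_neg_iff_add_eq_0)

lemma raw_act_diff: "raw_act p (F - G) = raw_act p F - raw_act p G"
  using raw_act_add[of p F "- G"] by (simp add: raw_act_uminus)

lemma raw_act_smult: "raw_act p (smult g F) = raw_act p F * g"
proof -
  have "degree (smult g F) \<le> degree F"
    by (rule degree_smult_le)
  thus ?thesis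
    by (simp add: raw_act_bound[where N = "degree F"] sum_distrib_left mult_ac)
qed

lemma raw_act_sum: "raw_act p (\<Sum>i\<in>A. F i) = (\<Sum>i\<in>A. raw_act p (F i))"
  by (induction A rule: infinite_finite_induct) (auto simp: raw_act_add)

lemma funpow_pderiv_0 [simp]: "(pderiv ^^ j) (0 :: complex poly) = 0"
  by (induction j) auto

lemma funpow_pderiv_add: "(pderiv ^^ j) (p + q :: complex poly) = (pderiv ^^ j) p + (pderiv ^^ j) q"
  by (induction j) (auto simp: pderiv_add)

lemma raw_act_0_left [simp]: "raw_act 0 F = 0"
  by (simp add: raw_act_def)

lemma raw_act_add_left: "raw_act (p + q) F = raw_act p F + raw_act q F"
  by (simp add: raw_act_def funpow_pderiv_add sum.distrib algebra_simps)

lemma pderiv_sum_fun: "pderiv (\<Sum>i\<in>A. f i :: complex poly) = (\<Sum>i\<in>A. pderiv (f i))"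
  by (induction A rule: infinite_finite_induct) (auto simp: pderiv_add)

lemma smult_sum_fun: "smult c (\<Sum>i\<in>A. f i :: complex poly) = (\<Sum>i\<in>A. smult c (f i))"
  by (induction A rule: infinite_finite_induct) (auto simp: smult_add_right)

lemma raw_act_times_partial: "raw_act p (raw_times_partial F) = pderiv (raw_act p F)"
proof -
  define N where "N = degree F"
  have 1: "degree (pCons 0 F) \<le> Suc N"
    by (simp add: N_def degree_pCons_le)
  have 2: "degree (map_poly pderiv F) \<le> N"
    by (intro degree_le) (simp add: N_def coeff_map_poly coeff_eq_0)
  have "raw_act p (pCons 0 F) = (\<Sum>j\<le>Suc N. (pderiv ^^ j) p * coeff (pCons 0 F) j)"
    by (rule raw_act_bound[OF 1])
  also have "\<dots> = (\<Sum>j\<le>N. (pderiv ^^ Suc j) p * coeff F j)"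
    by (subst sum.atMost_Suc_shift) simp
  finally show ?thesis
    unfolding raw_times_partial_def raw_act_add raw_act_bound[OF 2]
      raw_act_bound[OF order.refl[of "degree F"]] N_def
    by (simp add: coeff_map_poly pderiv_sum_fun pderiv_mult sum.distrib algebra_simps)
qed

lemma raw_act_times: "raw_act p (raw_times F G) = raw_act (raw_act p F) G"
proof -
  have "raw_act p ((raw_times_partial ^^ j) F) = (pderiv ^^ j) (raw_act p F)" for j
    by (induction j) (auto simp: raw_act_times_partial)
  thus ?thesis
    by (simp add: raw_times_def raw_act_sum raw_act_smult raw_act_def[of "raw_act p F"])
qed

lemma funpow_pderiv_monom_less:
  "m < j \<Longrightarrow> (pderiv ^^ j) (monom (c :: complex) m) = 0"
proof (induction j arbitrary: m c)
  case (Suc j)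
  show ?case
  proof (cases m)
    case 0
    thus ?thesis by (simp add: funpow_Suc_right pderiv_monom del: funpow.simps)
  next
    case (Suc k)
    with Suc.prems Suc.IH[of k] show ?thesis
      by (simp add: funpow_Suc_right pderiv_monom del: funpow.simps)
  qed
qed auto

lemma funpow_pderiv_monom_self:
  "(pderiv ^^ m) (monom (c :: complex) m) = [:fact m * c:]"
proof (induction m arbitrary: c)
  case (Suc m)
  show ?case
    using Suc.IH[of "of_nat (Suc m) * c"]
    by (simp add: funpow_Suc_right pderiv_monom algebra_simps del: funpow.simps)
qed (auto simp: monom_0)

lemma raw_act_faithful:
  assumes "\<And>p. raw_act p F = 0"
  shows "F = 0"
proof (rule poly_eqI)
  fix m
  show "coeff F m = coeff 0 m"
  proof (induction m rule: less_induct)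
    case (less m)
    define N where "N = max m (degree F)"
    have "0 = raw_act (monom 1 m) F"
      by (simp add: assms)
    also have "\<dots> = (\<Sum>j\<le>N. (pderiv ^^ j) (monom 1 m) * coeff F j)"
      by (rule raw_act_bound) (simp add: N_def)
    also have "\<dots> = (\<Sum>j\<in>{m}. (pderiv ^^ j) (monom 1 m) * coeff F j)"
    proof (rule sum.mono_neutral_right)
      show "\<forall>j\<in>{..N} - {m}. (pderiv ^^ j) (monom 1 m) * coeff F j = 0"
      proof
        fix j assume "j \<in> {..N} - {m}"
        hence "j < m \<or> m < j" by auto
        thus "(pderiv ^^ j) (monom 1 m) * coeff F j = 0"
          using less funpow_pderiv_monom_less[of m j 1] by auto
      qed
    qed (auto simp: N_def)
    also have "\<dots> = smult (fact m) (coeff F m)"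
      by (simp add: funpow_pderiv_monom_self)
    finally show ?case
      by simp
  qed
qed

lemma raw_eqI:
  assumes "\<And>p. raw_act p F = raw_act p G"
  shows "F = G"
  using raw_act_faithful[of "F - G"] assms by (simp add: raw_act_diff)

instantiation diff_op :: ring_1
begin

definition "0 = Diff_Op 0"
definition "1 = Diff_Op 1"
definition "D + E = Diff_Op (op_coeffs D + op_coeffs E)"
definition "D - E = Diff_Op (op_coeffs D - op_coeffs E)"
definition "- D = Diff_Op (- op_coeffs D)"
definition "D * E = Diff_Op (raw_times (op_coeffs D) (op_coeffs E))"

lemmas diff_op_defs = zero_diff_op_def one_diff_op_def plus_diff_op_def minus_diff_op_def
  uminus_diff_op_def times_diff_op_def Diff_Op_inverse[OF UNIV_I]

lemma act_times: "p \<cdot> (D * E) = (p \<cdot> D) \<cdot> E"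
  by (simp add: act_def diff_op_defs raw_act_times)

lemma act_add: "p \<cdot> (D + E) = p \<cdot> D + p \<cdot> E"
  by (simp add: act_def diff_op_defs raw_act_add)

lemma act_diff: "p \<cdot> (D - E) = p \<cdot> D - p \<cdot> E"
  by (simp add: act_def diff_op_defs raw_act_diff)

lemma act_uminus: "p \<cdot> (- D) = - (p \<cdot> D)"
  by (simp add: act_def diff_op_defs raw_act_uminus)

lemma act_zero: "p \<cdot> 0 = 0"
  by (simp add: act_def diff_op_defs)

lemma act_one: "p \<cdot> 1 = p"
  by (simp add: act_def diff_op_defs)

lemma act_add_left: "(p + q) \<cdot> D = p \<cdot> D + q \<cdot> D"
  by (simp add: act_def raw_act_add_left)

lemma diff_op_eqI:
  assumes "\<And>p. p \<cdot> D = p \<cdot> E"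
  shows "D = E"
proof -
  have "op_coeffs D = op_coeffs E"
    by (rule raw_eqI) (use assms in \<open>simp add: act_def\<close>)
  thus ?thesis
    by (simp add: op_coeffs_inject)
qed

instance
proof
  have "(1 :: complex poly) \<cdot> 0 \<noteq> 1 \<cdot> 1"
    by (simp only: act_zero act_one) simp
  thus "(0 :: diff_op) \<noteq> 1"
    by metis
qed (rule diff_op_eqI, simp add: act_times act_add act_diff act_uminus act_zero act_one
       act_add_left algebra_simps)+

end

definition partial :: diff_op  ("\<partial>") where
  "\<partial> = Diff_Op [:0, 1:]"

definition mult_op :: "complex poly \<Rightarrow> diff_op" where
  "mult_op f = Diff_Op [:f:]"

lemma act_partial: "p \<cdot> \<partial> = pderiv p"
  by (simp add: act_def partial_def raw_act_def Diff_Op_inverse)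

lemma act_mult_op: "p \<cdot> mult_op f = p * f"
  by (simp add: act_def mult_op_def raw_act_def Diff_Op_inverse)

text \<open>
  The zero polynomial is treated as having degree \<open>-\<infinity>\<close>; as \<open>degree 0 = 0\<close> in the library, the
  condition on constants has to exclude that they are mapped to \<open>0\<close>.
\<close>

definition degree_preserving :: "diff_op \<Rightarrow> bool" where
  "degree_preserving V \<longleftrightarrow> (\<forall>p. p \<noteq> 0 \<longrightarrow> p \<cdot> V \<noteq> 0 \<and> degree (p \<cdot> V) = degree p)"


section \<open>Scalar weights and their orthogonal polynomials\<close>

text \<open>
  A weight consists of its interval and its density.  In the instances below densities are extended
  by \<open>0\<close> outside the interval, so that equality of weights is equality of the functions on the
  interval.
\<close>

datatype weight = Weight (interval: "real set") (density: "real \<Rightarrow> real")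

definition hermite_weight :: "real \<Rightarrow> weight" where
  "hermite_weight b = Weight UNIV (\<lambda>x. exp (- x\<^sup>2 + 2 * b * x))"

definition laguerre_weight :: "real \<Rightarrow> weight" where
  "laguerre_weight \<alpha> =
     Weight {0<..} (\<lambda>x. if x \<in> {0<..} then exp (- x) * x powr \<alpha> else 0)"

definition jacobi_weight :: "real \<Rightarrow> real \<Rightarrow> weight" where
  "jacobi_weight \<alpha> \<beta> =
     Weight {-1<..<1} (\<lambda>x. if x \<in> {-1<..<1} then (1 - x) powr \<alpha> * (1 + x) powr \<beta> else 0)"

definition same_type_classical :: "weight \<Rightarrow> weight \<Rightarrow> bool" where
  "same_type_classical w1 w2 \<longleftrightarrow>
     (\<exists>b1 b2. w1 = hermite_weight b1 \<and> w2 = hermite_weight b2) \<or>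
     (\<exists>\<alpha>1 \<alpha>2. \<alpha>1 > -1 \<and> \<alpha>2 > -1 \<and> w1 = laguerre_weight \<alpha>1 \<and> w2 = laguerre_weight \<alpha>2) \<or>
     (\<exists>\<alpha>1 \<beta>1 \<alpha>2 \<beta>2. \<alpha>1 > -1 \<and> \<beta>1 > -1 \<and> \<alpha>2 > -1 \<and> \<beta>2 > -1 \<and>
        w1 = jacobi_weight \<alpha>1 \<beta>1 \<and> w2 = jacobi_weight \<alpha>2 \<beta>2)"

definition weight_inner :: "weight \<Rightarrow> complex poly \<Rightarrow> complex poly \<Rightarrow> complex" where
  "weight_inner w p q =
     (LINT x:interval w|lborel.
        complex_of_real (density w x) * poly p (complex_of_real x) * cnj (poly q (complex_of_real x)))"

definition monic_orthogonal :: "weight \<Rightarrow> (nat \<Rightarrow> complex poly) \<Rightarrow> bool" where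
  "monic_orthogonal w P \<longleftrightarrow>
     (\<forall>n. degree (P n) = n \<and> lead_coeff (P n) = 1) \<and>
     (\<forall>m n. m \<noteq> n \<longrightarrow> weight_inner w (P m) (P n) = 0)"

text \<open>
  For a positive weight with finite moments, in particular for the classical ones above, the sequence
  of monic orthogonal polynomials exists and is unique.
\<close>

definition monic_op :: "weight \<Rightarrow> nat \<Rightarrow> complex poly" where
  "monic_op w = (THE P. monic_orthogonal w P)"

definition op_space :: "weight \<Rightarrow> weight \<Rightarrow> diff_op set"  ("\<D>'(_, _')") where
  "\<D>(w1, w2) = {T. \<exists>\<Lambda> :: nat \<Rightarrow> complex. \<forall>n. monic_op w1 n \<cdot> T = smult (\<Lambda> n) (monic_op w2 n)}"

abbreviation op_alg :: "weight \<Rightarrow> diff_op set"  ("\<D>'(_')") where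
  "\<D>(w) \<equiv> \<D>(w, w)"

lemma op_space_add:
  assumes "S \<in> \<D>(w1, w2)" "T \<in> \<D>(w1, w2)"
  shows "S + T \<in> \<D>(w1, w2)"
proof -
  from assms obtain \<Lambda> \<Gamma> where
    "\<And>n. monic_op w1 n \<cdot> S = smult (\<Lambda> n) (monic_op w2 n)"
    "\<And>n. monic_op w1 n \<cdot> T = smult (\<Gamma> n) (monic_op w2 n)"
    by (auto simp: op_space_def)
  hence "\<forall>n. monic_op w1 n \<cdot> (S + T) = smult (\<Lambda> n + \<Gamma> n) (monic_op w2 n)"
    by (simp add: act_add smult_add_left)
  thus ?thesis
    unfolding op_space_def by (intro CollectI exI[of _ "\<lambda>n. \<Lambda> n + \<Gamma> n"]) simp
qed

lemma op_alg_one: "1 \<in> \<D>(w)"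
  unfolding op_space_def by (auto simp: act_one intro!: exI[of _ "\<lambda>_. 1"])

lemma act_smult_left: "smult c p \<cdot> T = smult c (p \<cdot> T)"
proof -
  have "(pderiv ^^ j) (smult c p) = smult c ((pderiv ^^ j) p)" for j
    by (induction j) (auto simp: pderiv_smult)
  thus ?thesis
    by (simp add: act_def raw_act_def smult_sum_fun)
qed

lemma op_space_times:
  assumes "S \<in> \<D>(w1, w2)" "T \<in> \<D>(w2, w3)"
  shows "S * T \<in> \<D>(w1, w3)"
proof -
  from assms obtain \<Lambda> \<Gamma> where
    "\<And>n. monic_op w1 n \<cdot> S = smult (\<Lambda> n) (monic_op w2 n)"
    "\<And>n. monic_op w2 n \<cdot> T = smult (\<Gamma> n) (monic_op w3 n)"
    by (auto simp: op_space_def)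
  hence "\<forall>n. monic_op w1 n \<cdot> (S * T) = smult (\<Lambda> n * \<Gamma> n) (monic_op w3 n)"
    by (simp add: act_times act_smult_left)
  thus ?thesis
    unfolding op_space_def by (intro CollectI exI[of _ "\<lambda>n. \<Lambda> n * \<Gamma> n"]) simp
qed

definition darboux_transformation_of :: "weight \<Rightarrow> weight \<Rightarrow> bool" where
  "darboux_transformation_of w' w \<longleftrightarrow>
     interval w' = interval w \<and>
     (\<exists>D\<in>\<D>(w). \<exists>V N. D = V * N \<and> degree_preserving V \<and> degree_preserving N \<and>
        (\<exists>A :: nat \<Rightarrow> complex. \<forall>n. monic_op w n \<cdot> V = smult (A n) (monic_op w' n)))"

end

theory Submission
  imports Defs "HOL-Probability.Distributions" "HOL-Real_Asymp.Real_Asymp"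
begin

text \<open>
  For polynomials \<open>A\<close> and \<open>B\<close> let \<open>\<delta>\<close> be the operator \<open>p \<mapsto> A p'' + B p'\<close>. A classical weight \<open>w\<close> satisfies a
  Pearson equation \<open>(A w)' = B w\<close>, where \<open>A\<close> is \<open>1\<close>, \<open>x\<close> or \<open>1 - x\<^sup>2\<close> depending on the type only, and \<open>B\<close> is linear
  and carries the parameters. Integration by parts makes \<open>\<delta>\<close> symmetric, so the monic orthogonal
  polynomials of \<open>w\<close> are its eigenpolynomials (\<open>eigen_family_monic_op\<close>); the eigenvalues
  \<open>n ((n - 1) A\<^sub>2 + B\<^sub>1)\<close> are pairwise distinct.

  Suppose that \<open>\<delta>1\<close> and \<open>\<delta>2\<close>, belonging to \<open>w1\<close> and \<open>w2\<close>, have the same eigenvalues. This is always so for two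
  Hermite or two Laguerre weights, and for Jacobi weights with the same sum \<open>\<alpha> + \<beta>\<close>. Because the
  spectrum is simple, \<open>\<D>(w1, w2)\<close> consists of the operators \<open>T\<close> with \<open>\<delta>1 T = T \<delta>2\<close> (\<open>intertwiner_iff\<close>). If \<open>T\<close>
  has order \<open>m\<close> and leading coefficient \<open>f\<close>, comparing the coefficients of order \<open>m + 1\<close> gives
  \<open>2 A f' = (B1 - B2 + m A') f\<close> (\<open>intertwiner_leading_equation\<close>). Its polynomial solutions are explicit: for Hermite
  weights with \<open>b1 \<noteq> b2\<close> there are none; for Laguerre weights \<open>f\<close> is a multiple of \<open>x\<^sup>r\<close> with
  \<open>2 r = m + \<alpha>1 - \<alpha>2\<close>; for Jacobi weights \<open>f\<close> is a multiple of \<open>(x - 1)\<^sup>a (x + 1)\<^sup>b\<close> with \<open>a + b = m\<close> and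
  \<open>b - a = \<alpha>2 - \<alpha>1\<close>. So nonzero operators exist only for integral shifts of the parameters. For such a
  shift, the first-order operators in the statement intertwine neighbouring parameters, and their
  product \<open>T0\<close> has exactly the leading coefficient for which every possible \<open>f\<close> is that of some
  \<open>T0 \<delta>2\<^sup>r\<close>. Subtracting and descending in the order yields \<open>T = T0 S\<close> with \<open>S\<close> a polynomial in \<open>\<delta>2\<close>
  (\<open>intertwiner_cyclic\<close>). The product operators in the two directions preserve degrees, so in these cases the weights are
  Darboux transformations of each other; for the remaining distinct pairs the module is zero.

  For Jacobi weights with different sums \<open>\<alpha> + \<beta>\<close> the module is zero as well, for a different reason
  (\<open>op_space_eq_0_if_spectra_differ\<close>). Expanding at \<open>x = 1\<close>, the value and the derivative of \<open>p\<^sub>n \<cdot> T\<close> at this point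
  are, relative to \<open>p\<^sub>n(1)\<close>, polynomials in the eigenvalue \<open>\<lambda>\<^sub>n\<close>, which is quadratic in \<open>n\<close>. The
  eigenvalue equation for the image involves \<open>\<mu>\<^sub>n = \<lambda>\<^sub>n + d n\<close> with \<open>d \<noteq> 0\<close>, which would make \<open>n R(\<lambda>\<^sub>n)\<close> a
  polynomial in \<open>\<lambda>\<^sub>n\<close>. By the parity of degrees this is possible only for \<open>R = 0\<close>.
\<close>

section \<open>Leading coefficients of differential operators\<close>

abbreviation coeff_op :: "diff_op \<Rightarrow> nat \<Rightarrow> complex poly" where
  "coeff_op D i \<equiv> coeff (op_coeffs D) i"

lemma op_coeffs_simps:
  "op_coeffs 0 = 0" "op_coeffs 1 = 1" "op_coeffs (D + E) = op_coeffs D + op_coeffs E"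
  "op_coeffs (D - E) = op_coeffs D - op_coeffs E"
  "op_coeffs (D * E) = raw_times (op_coeffs D) (op_coeffs E)"
  "op_coeffs \<partial> = [:0, 1:]" "op_coeffs (mult_op f) = [:f:]"
  by (simp_all add: diff_op_defs partial_def mult_op_def)

lemma coeff_raw_times_partial:
  "coeff (raw_times_partial F) i = (if i = 0 then 0 else coeff F (i - 1)) + pderiv (coeff F i)"
  by (simp add: raw_times_partial_def coeff_pCons coeff_map_poly split: nat.split)

lemma coeff_op_times_partial:
  "coeff_op (D * \<partial>) i = (if i = 0 then 0 else coeff_op D (i - 1)) + pderiv (coeff_op D i)"
  by (simp add: op_coeffs_simps raw_times_def coeff_raw_times_partial)

lemma coeff_op_times_mult_op: "coeff_op (D * mult_op f) i = coeff_op D i * f"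
  by (simp add: op_coeffs_simps raw_times_def)

lemma coeff_funpow_raw_times_partial_eq_0:
  "coeff ((raw_times_partial ^^ j) F) i = 0" if "i > degree F + j"
  using that by (induction j arbitrary: i) (auto simp: coeff_raw_times_partial coeff_eq_0)

text \<open>
  The coefficient \<open>f\<close> is allowed to vanish, so that \<open>m\<close> is only an upper bound for the order. This keeps
  the rules for products free of nonvanishing conditions.
\<close>

definition leading :: "diff_op \<Rightarrow> nat \<Rightarrow> complex poly \<Rightarrow> bool" where
  "leading D m f \<longleftrightarrow> coeff_op D m = f \<and> (\<forall>i>m. coeff_op D i = 0)"

lemma leading_exists: "D \<noteq> 0 \<Longrightarrow> \<exists>m f. leading D m f \<and> f \<noteq> 0"
proof -
  assume "D \<noteq> 0"
  hence "op_coeffs D \<noteq> 0"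
    by (metis op_coeffs_inject op_coeffs_simps(1))
  thus ?thesis
    by (auto simp: leading_def coeff_eq_0 intro!: exI[of _ "degree (op_coeffs D)"])
qed

lemma leading_times_partial: "leading D m f \<Longrightarrow> leading (D * \<partial>) (Suc m) f"
  by (auto simp: leading_def coeff_op_times_partial)

lemma leading_times_mult_op: "leading D m f \<Longrightarrow> leading (D * mult_op g) m (f * g)"
  by (auto simp: leading_def coeff_op_times_mult_op)

lemma leading_add_lower: "leading D m f \<Longrightarrow> leading E k g \<Longrightarrow> k < m \<Longrightarrow> leading (D + E) m f"
  by (auto simp: leading_def op_coeffs_simps)

lemma leading_one: "leading 1 0 1"
  by (auto simp: leading_def op_coeffs_simps coeff_pCons' simp flip: pCons_one)

definition first_order :: "complex poly \<Rightarrow> complex \<Rightarrow> diff_op" where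
  "first_order h c = \<partial> * mult_op h + mult_op [:c:]"

text \<open>
  Multiplying from the right by \<open>\<partial> h\<close> only shifts and scales the coefficients at the top; all
  commutators have lower order.
\<close>

lemma leading_prod_first_order:
  "leading (prod_list (map (\<lambda>j. first_order h (c j)) js)) (length js) (h ^ length js)"
proof (induction js rule: rev_induct)
  case (snoc j js)
  let ?P = "prod_list (map (\<lambda>j. first_order h (c j)) js)"
  have "leading (?P * \<partial> * mult_op h + ?P * mult_op [:c j:]) (Suc (length js)) (h ^ length js * h)"
    by (rule leading_add_lower leading_times_mult_op leading_times_partial snoc lessI)+
  thus ?case
    by (simp add: first_order_def algebra_simps)
qed (auto simp: leading_one)

text \<open>
  The classical orthogonal polynomials are eigenpolynomials of operators of this form.
\<close>

definition second_order :: "complex poly \<Rightarrow> complex poly \<Rightarrow> diff_op" where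
  "second_order A B = \<partial> * \<partial> * mult_op A + \<partial> * mult_op B"

lemma act_second_order:
  "p \<cdot> second_order A B = pderiv (pderiv p) * A + pderiv p * B"
  by (simp add: second_order_def act_add act_times act_partial act_mult_op)

lemma act_first_order: "p \<cdot> first_order h c = pderiv p * h + smult c p"
  by (simp add: first_order_def act_add act_times act_partial act_mult_op)

lemma leading_times_second_order:
  assumes "leading D m f"
  shows "leading (D * second_order A B) (m + 2) (f * A)"
proof -
  have "leading (D * \<partial> * \<partial> * mult_op A + D * \<partial> * mult_op B) (Suc (Suc m)) (f * A)"
    by (rule leading_add_lower leading_times_mult_op leading_times_partial assms lessI)+
  thus ?thesis
    by (simp add: second_order_def algebra_simps)
qed

lemma leading_times_second_order_power:
  assumes "leading D m f"
  shows "leading (D * second_order A B ^ r) (m + 2 * r) (f * A ^ r)"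
proof (induction r)
  case (Suc r)
  from leading_times_second_order[OF Suc, of A B] show ?case
    by (simp add: power_Suc2 algebra_simps del: power_Suc)
qed (use assms in auto)

lemma op_coeffs_second_order: "op_coeffs (second_order A B) = [:0, B, A:]"
proof -
  have "coeff_op (second_order A B) i = coeff [:0, B, A:] i" for i
    by (auto simp: second_order_def op_coeffs_simps(3,6) coeff_op_times_mult_op
       coeff_op_times_partial coeff_pCons pderiv_1 split: nat.splits)
  thus ?thesis by (rule poly_eqI)
qed

lemma coeff_partial_pow_second_order:
  "coeff ((raw_times_partial ^^ j) [:0, B, A:]) (Suc (Suc j)) = A \<and>
   coeff ((raw_times_partial ^^ j) [:0, B, A:]) (Suc j) = B + of_nat j * pderiv A"
proof (induction j)
  case (Suc j)
  have "coeff ((raw_times_partial ^^ j) [:0, B, A:]) (Suc (Suc (Suc j))) = 0"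
    by (rule coeff_funpow_raw_times_partial_eq_0) auto
  with Suc show ?case
    by (auto simp: coeff_raw_times_partial pderiv_add pderiv_mult algebra_simps)
qed auto

text \<open>
  In \<open>\<partial>\<^sup>2 A\<close> followed by \<open>\<partial>\<^sup>m f\<close> derivatives fall on \<open>A\<close>, in the opposite order they fall on \<open>f\<close>. The coefficient of order
  \<open>m + 1\<close>, one below the top, is the first one that sees the difference; the contribution of the
  second highest coefficient of \<open>T\<close> is the same in both products.
\<close>

lemma coeff_second_order_times:
  assumes "leading T m f"
  shows "coeff_op (second_order A B * T) (Suc m) =
           f * (B + of_nat m * pderiv A) + (if m = 0 then 0 else coeff_op T (m - 1) * A)"
proof -
  let ?D = "\<lambda>j. (raw_times_partial ^^ j) [:0, B, A:]"
  let ?F = "op_coeffs T"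
  have deg: "degree ?F \<le> m"
    using assms by (intro degree_le) (auto simp: leading_def)
  have "coeff_op (second_order A B * T) (Suc m) =
          (\<Sum>j\<le>degree ?F. coeff ?F j * coeff (?D j) (Suc m))"
    by (simp add: op_coeffs_simps op_coeffs_second_order raw_times_def coeff_sum)
  also have "\<dots> = (\<Sum>j\<le>m. coeff ?F j * coeff (?D j) (Suc m))"
    using deg by (intro sum.mono_neutral_left) (auto simp: coeff_eq_0)
  also have "\<dots> = (\<Sum>j\<in>{m - 1..m}. coeff ?F j * coeff (?D j) (Suc m))"
    by (intro sum.mono_neutral_right) (auto intro!: coeff_funpow_raw_times_partial_eq_0)
  also have "\<dots> = f * (B + of_nat m * pderiv A) + (if m = 0 then 0 else coeff_op T (m - 1) * A)"
  proof (cases m)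
    case 0
    thus ?thesis using assms coeff_partial_pow_second_order[of 0 B A] by (simp add: leading_def)
  next
    case (Suc k)
    have "{k..Suc k} = {k, Suc k}" by auto
    thus ?thesis using Suc assms coeff_partial_pow_second_order[of k B A]
        coeff_partial_pow_second_order[of "Suc k" B A] by (simp add: leading_def del: funpow.simps)
  qed
  finally show ?thesis .
qed

lemma coeff_times_second_order:
  assumes "leading T m f"
  shows "coeff_op (T * second_order A B) (Suc m) =
           f * B + 2 * pderiv f * A + (if m = 0 then 0 else coeff_op T (m - 1) * A)"
proof -
  have "T * second_order A B = T * \<partial> * \<partial> * mult_op A + T * \<partial> * mult_op B"
    by (simp add: second_order_def algebra_simps)
  hence "coeff_op (T * second_order A B) (Suc m) =
      coeff_op (T * \<partial> * \<partial> * mult_op A) (Suc m) + coeff_op (T * \<partial> * mult_op B) (Suc m)"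
    by (simp add: op_coeffs_simps(3))
  also have "\<dots> = f * B + 2 * pderiv f * A + (if m = 0 then 0 else coeff_op T (m - 1) * A)"
    unfolding coeff_op_times_mult_op coeff_op_times_partial
    using assms by (auto simp add: leading_def
        algebra_simps pderiv_add)
  finally show ?thesis .
qed

text \<open>
  Commuting past \<open>T\<close> forces a first-order linear differential equation on its leading coefficient:
  the contributions of \<open>coeff_op T (m - 1)\<close> cancel. This equation is so rigid that it decides
  which pairs of weights have a nonzero operator between them.
\<close>

lemma intertwiner_leading_equation:
  assumes "leading T m f" "second_order A B1 * T = T * second_order A B2"
  shows "2 * A * pderiv f = (B1 - B2 + of_nat m * pderiv A) * f"
proof -
  have "f * (B1 + of_nat m * pderiv A) = f * B2 + 2 * pderiv f * A"
    using coeff_second_order_times[OF assms(1), of A B1] coeff_times_second_order[OF assms(1), of A B2]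
      assms(2) by (simp split: if_splits)
  thus ?thesis by (simp add: algebra_simps)
qed

lemma mult_op_const_commute: "mult_op [:c:] * D = D * mult_op [:c:]"
  by (rule diff_op_eqI) (simp add: act_times act_mult_op act_smult_left)

text \<open>
  Induction on the order. If every possible leading coefficient is, up to a constant, that of some
  \<open>T0 \<delta>2\<^sup>r\<close>, then a multiple of \<open>T0 \<delta>2\<^sup>r\<close> can be subtracted to lower the order, and the difference is
  again an intertwiner. The quotient \<open>S\<close> is therefore a polynomial in \<open>\<delta>2\<close>.
\<close>

lemma intertwiner_cyclic:
  assumes T0: "\<delta>1 * T0 = T0 * \<delta>2" "leading T0 k g" and \<delta>2: "\<delta>2 = second_order A B"
    and symbols: "\<And>T m f. \<delta>1 * T = T * \<delta>2 \<Longrightarrow> leading T m f \<Longrightarrow> f \<noteq> 0 \<Longrightarrow>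
       \<exists>r c. m = k + 2 * r \<and> f = smult c (g * A ^ r)"
    and T: "\<delta>1 * T = T * \<delta>2"
  shows "\<exists>S. T = T0 * S \<and> \<delta>2 * S = S * \<delta>2"
proof -
  have comm: "\<delta>2 * \<delta>2 ^ r = \<delta>2 ^ r * \<delta>2" for r
    by (simp add: power_commutes)
  have "\<exists>S. T = T0 * S \<and> \<delta>2 * S = S * \<delta>2" if "\<forall>i\<ge>N. coeff_op T i = 0" "\<delta>1 * T = T * \<delta>2" for N T
    using that
  proof (induction N arbitrary: T)
    case 0
    hence "T = 0"
      by (metis leading_def leading_exists le0)
    thus ?case by (intro exI[of _ 0]) auto
  next
    case (Suc N)
    show ?case
    proof (cases "coeff_op T N = 0")
      case True
      with Suc.prems have "\<forall>i\<ge>N. coeff_op T i = 0"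
        by (metis not_less_eq_eq order_antisym_conv)
      thus ?thesis using Suc by blast
    next
      case False
      with Suc.prems have lead: "leading T N (coeff_op T N)"
        by (auto simp: leading_def)
      from symbols[OF Suc.prems(2) this False] obtain r c where
        rc: "N = k + 2 * r" "coeff_op T N = smult c (g * A ^ r)" by auto
      \<comment> \<open>The constant is placed to the right of the power, where it commutes with everything.\<close>
      define S0 where "S0 = \<delta>2 ^ r * mult_op [:c:]"
      have "leading (T0 * \<delta>2 ^ r * mult_op [:c:]) N (g * A ^ r * [:c:])"
        unfolding rc \<delta>2 by (intro leading_times_mult_op leading_times_second_order_power T0)
      hence lead': "leading (T0 * S0) N (coeff_op T N)"
        using rc(2) by (simp add: S0_def mult.assoc)
      have S0: "\<delta>2 * S0 = S0 * \<delta>2"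
        unfolding S0_def mult.assoc mult_op_const_commute[of c \<delta>2]
        by (simp only: mult.assoc[symmetric] comm)
      have "\<forall>i\<ge>N. coeff_op (T - T0 * S0) i = 0"
        using lead lead' by (auto simp: leading_def op_coeffs_simps(4) le_less)
      moreover have "\<delta>1 * (T - T0 * S0) = (T - T0 * S0) * \<delta>2"
      proof -
        have "\<delta>1 * (T0 * S0) = T0 * (\<delta>2 * S0)"
          by (simp only: mult.assoc[symmetric] T0(1))
        thus ?thesis
          by (simp only: right_diff_distrib left_diff_distrib Suc.prems(2) S0 mult.assoc)
      qed
      ultimately obtain S where "T - T0 * S0 = T0 * S" "\<delta>2 * S = S * \<delta>2"
        using Suc.IH by blast
      hence "T = T0 * (S0 + S)" "\<delta>2 * (S0 + S) = (S0 + S) * \<delta>2"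
        using S0 by (simp_all add: distrib_left distrib_right diff_eq_eq add.commute)
      thus ?thesis by blast
    qed
  qed
  from this[of "Suc (degree (op_coeffs T))" T] T show ?thesis
    by (auto simp: coeff_eq_0)
qed

section \<open>Polynomial solutions of the equation for the leading coefficient\<close>

text \<open>
  Differentiation lowers the degree, so it has no nonzero eigenvalue on polynomials.
\<close>

lemma hermite_symbol:
  assumes "2 * pderiv f = [:d:] * f" "d \<noteq> 0"
  shows "f = (0 :: complex poly)"
proof (rule ccontr)
  assume "f \<noteq> 0"
  from assms(1) have "pderiv f + pderiv f = smult d f"
    by (simp only: mult_2 mult_pCons_left) simp
  hence "coeff (pderiv f + pderiv f) (degree f) = coeff (smult d f) (degree f)"
    by (rule arg_cong)
  hence "coeff (pderiv f) (degree f) + coeff (pderiv f) (degree f) = d * coeff f (degree f)"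
    by (simp only: coeff_add coeff_smult)
  thus False
    using \<open>f \<noteq> 0\<close> \<open>d \<noteq> 0\<close> by (simp add: coeff_pderiv coeff_eq_0)
qed

text \<open>
  The operator \<open>x d/dx\<close> is diagonal on monomials with distinct eigenvalues.
\<close>

lemma laguerre_symbol:
  fixes f :: "complex poly"
  assumes "2 * [:0, 1:] * pderiv f = [:c:] * f" "f \<noteq> 0"
  shows "\<exists>r a. c = 2 * of_nat r \<and> f = smult a ([:0, 1:] ^ r)"
proof -
  have eq: "2 * of_nat i * coeff f i = c * coeff f i" for i
  proof -
    have "coeff (2 * [:0, 1:] * pderiv f) i = coeff ([:c:] * f) i"
      by (simp only: assms(1))
    also have "2 * [:0, 1:] * pderiv f = smult 2 (pCons 0 (pderiv f))"
      by (simp add: numeral_poly)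
    finally show ?thesis
      by (cases i) (simp_all add: coeff_pderiv)
  qed
  have c: "c = 2 * of_nat (degree f)"
    using eq[of "degree f"] assms(2) by simp
  have "coeff f i = 0" if "i \<noteq> degree f" for i
    using eq[of i] that unfolding c by auto
  hence "f = monom (lead_coeff f) (degree f)"
    by (intro poly_eqI) auto
  hence "f = smult (lead_coeff f) ([:0, 1:] ^ degree f)"
    by (simp add: monom_altdef)
  thus ?thesis using c by blast
qed

lemma pderiv_linear_power:
  "pderiv ([:c, 1:] ^ a) * [:c, 1:] = of_nat a * [:c, 1 :: complex:] ^ a"
proof (cases a)
  case (Suc k)
  have "pderiv ([:c, 1:] ^ Suc k) = smult (of_nat (Suc k)) ([:c, 1:] ^ k)"
    by (simp only: pderiv_power_Suc) (simp add: pderiv_pCons)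
  hence "pderiv ([:c, 1:] ^ Suc k) * [:c, 1:] = smult (of_nat (Suc k)) ([:c, 1:] ^ k * [:c, 1:])"
    by (simp only: mult_smult_left)
  also have "\<dots> = of_nat (Suc k) * [:c, 1:] ^ Suc k"
    by (simp only: of_nat_poly power_Suc2 mult_pCons_left mult_zero_left pCons_0_0 add_0_right)
  finally show ?thesis unfolding Suc .
qed (simp add: pderiv_1)

text \<open>
  The logarithmic derivative of \<open>f\<close> has poles only at \<open>\<plusminus>1\<close>. After splitting off the zeros of \<open>f\<close> at these two
  points, the cofactor \<open>h\<close> satisfies \<open>(x\<^sup>2 - 1) h' = l h\<close> with \<open>l\<close> linear and \<open>h(\<plusminus>1) \<noteq> 0\<close>. Hence \<open>l\<close> vanishes at both
  points, so \<open>l = 0\<close> and \<open>h\<close> is constant.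
\<close>

lemma jacobi_symbol:
  fixes f :: "complex poly"
  assumes eq: "2 * [:1, 0, -1:] * pderiv f = [:2 * e, -2 * of_nat m:] * f" and f: "f \<noteq> 0"
  shows "\<exists>a b c. f = smult c ([:-1, 1:] ^ a * [:1, 1:] ^ b) \<and> m = a + b \<and> e = of_nat b - of_nat a"
proof -
  define X Y :: "complex poly" where "X = [:-1, 1:]" and "Y = [:1, 1:]"
  obtain g where g: "f = X ^ order 1 f * g" "\<not> X dvd g"
    using order_decomp[OF f, of 1] by (auto simp: X_def)
  hence "g \<noteq> 0" by auto
  from order_decomp[OF this, of "-1"] obtain h where h: "g = Y ^ order (-1) g * h" "\<not> Y dvd h"
    by (auto simp: Y_def)
  define a b where "a = order 1 f" and "b = order (-1) g"
  have fab: "f = X ^ a * Y ^ b * h"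
    using g(1) h(1) by (simp add: a_def b_def mult.assoc)
  have h1: "poly h 1 \<noteq> 0"
    using g(2) h(1) by (metis X_def dvd_mult poly_eq_0_iff_dvd)
  have h2: "poly h (-1) \<noteq> 0"
    using h(2) by (simp add: Y_def poly_eq_0_iff_dvd)
  \<comment> \<open>Multiplying by \<open>X\<close> and \<open>Y\<close> keeps the powers intact and avoids the exponents \<open>a - 1\<close> and \<open>b - 1\<close>.\<close>
  have dX: "pderiv (X ^ a) * X = of_nat a * X ^ a" and dY: "pderiv (Y ^ b) * Y = of_nat b * Y ^ b"
    by (simp_all only: X_def Y_def pderiv_linear_power)
  have "pderiv f * (X * Y) = (pderiv (X ^ a) * X) * Y * Y ^ b * h
      + (pderiv (Y ^ b) * Y) * X * X ^ a * h + X ^ a * Y ^ b * (X * Y * pderiv h)"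
    unfolding fab pderiv_mult by (simp add: algebra_simps)
  hence df: "pderiv f * (X * Y) =
      X ^ a * Y ^ b * (of_nat a * Y * h + of_nat b * X * h + X * Y * pderiv h)"
    unfolding dX dY by (simp add: algebra_simps)
  have lhs: "2 * [:1, 0, -1:] * pderiv f = smult (-2) (pderiv f * (X * Y))"
    by (simp add: X_def Y_def numeral_poly smult_diff_right)
  have "smult (-2) (X ^ a * Y ^ b * (of_nat a * Y * h + of_nat b * X * h + X * Y * pderiv h))
      = [:2 * e, -2 * of_nat m:] * (X ^ a * Y ^ b * h)"
    using eq unfolding lhs df by (simp only: fab)
  hence "X ^ a * Y ^ b * smult (-2) (of_nat a * Y * h + of_nat b * X * h + X * Y * pderiv h)
      = X ^ a * Y ^ b * ([:2 * e, -2 * of_nat m:] * h)"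
    by (simp only: mult_smult_right mult.left_commute[of _ "X ^ a * Y ^ b" h])
  hence main: "smult (-2) (of_nat a * Y * h + of_nat b * X * h + X * Y * pderiv h) =
      [:2 * e, -2 * of_nat m:] * h"
    by (subst (asm) mult_left_cancel) (simp_all add: X_def Y_def)
  from arg_cong[OF main, of "\<lambda>p. poly p 1"] 
  have "2 * ((e - of_nat m + 2 * of_nat a) * poly h 1) = 0"
    by (simp add: X_def Y_def of_nat_poly algebra_simps)
  with h1 have "e - of_nat m + 2 * of_nat a = 0"
    by (simp only: mult_eq_0_iff) simp
  hence 1: "e = of_nat m - 2 * of_nat a"
    by algebra
  from arg_cong[OF main, of "\<lambda>p. poly p (-1)"]
  have "2 * ((e + of_nat m - 2 * of_nat b) * poly h (-1)) = 0"
    by (simp add: X_def Y_def of_nat_poly algebra_simps)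
  with h2 have "e + of_nat m - 2 * of_nat b = 0"
    by (simp only: mult_eq_0_iff) simp
  hence 2: "e = 2 * of_nat b - of_nat m"
    by algebra
  have "of_nat m = (of_nat (a + b) :: complex)"
    using 1 2 unfolding of_nat_add by algebra
  hence m: "m = a + b"
    by (simp only: of_nat_eq_iff)
  have e: "e = of_nat b - of_nat a"
    using 1 m by simp
  have "smult (-2) (of_nat a * Y * h + of_nat b * X * h) = [:2 * e, -2 * of_nat m:] * h"
  proof -
    have "smult (-2) (of_nat a * Y + of_nat b * X) = [:2 * e, -2 * of_nat m:]"
      unfolding e m by (simp add: X_def Y_def of_nat_poly algebra_simps)
    thus ?thesis by (simp only: distrib_right[symmetric] mult_smult_left[symmetric])
  qed
  with main have "smult (-2) (X * Y * pderiv h) = 0"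
    by (simp only: smult_add_right) simp
  hence "pderiv h = 0"
    by (simp only: smult_eq_0_iff mult_eq_0_iff) (simp add: X_def Y_def)
  then obtain c where "h = [:c:]"
    by (metis pderiv_eq_0_iff degree_eq_zeroE)
  hence "f = smult c ([:-1, 1:] ^ a * [:1, 1:] ^ b)"
    by (simp add: fab X_def Y_def)
  thus ?thesis using m e by blast
qed

section \<open>Monic polynomial sequences\<close>

text \<open>
  A property of polynomials of degree less than \<open>m\<close> may be checked on a monic sequence, since its first
  \<open>m\<close> members span this space.
\<close>

lemma monic_sequence_induct:
  fixes P :: "nat \<Rightarrow> complex poly"
  assumes P: "\<And>n. degree (P n) = n" "\<And>n. lead_coeff (P n) = 1"
    and p: "\<forall>i\<ge>m. coeff p i = 0"
    and R: "R 0" "\<And>n c r. n < m \<Longrightarrow> R r \<Longrightarrow> R (smult c (P n) + r)"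
  shows "R p"
  using p R(2)
proof (induction m arbitrary: p)
  case 0
  hence "p = 0" by (intro poly_eqI) auto
  thus ?case using R(1) by simp
next
  case (Suc m)
  define r where "r = p - smult (coeff p m) (P m)"
  have "\<forall>i\<ge>m. coeff r i = 0"
  proof (intro allI impI)
    fix i assume "i \<ge> m"
    thus "coeff r i = 0"
      using Suc.prems(1) P(1)[of m] P(2)[of m]
      by (cases "i = m") (auto simp: r_def coeff_eq_0)
  qed
  hence "R r"
    by (rule Suc.IH) (use Suc.prems(2) in auto)
  hence "R (smult (coeff p m) (P m) + r)"
    by (intro Suc.prems(2)) auto
  thus ?case by (simp add: r_def)
qed

lemma monic_sequence_diff_op_eqI:
  fixes P :: "nat \<Rightarrow> complex poly"
  assumes P: "\<And>n. degree (P n) = n" "\<And>n. lead_coeff (P n) = 1"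
    and eq: "\<And>n. P n \<cdot> D = P n \<cdot> E"
  shows "D = E"
proof (rule diff_op_eqI)
  fix p
  show "p \<cdot> D = p \<cdot> E"
  proof (rule monic_sequence_induct[OF P, where p = p and m = "Suc (degree p)"])
    show "0 \<cdot> D = 0 \<cdot> E" by (simp add: act_def)
  qed (auto simp: act_add_left act_smult_left eq coeff_eq_0)
qed

section \<open>Eigenpolynomials\<close>

text \<open>
  The coefficient of \<open>x\<^sup>n\<close> in \<open>A (x\<^sup>n)'' + B (x\<^sup>n)'\<close>. At \<open>n = 0\<close> the truncated \<open>n - 1\<close> is harmless because of the
  factor \<open>n\<close>.
\<close>

definition eigenvalue :: "complex poly \<Rightarrow> complex poly \<Rightarrow> nat \<Rightarrow> complex" where
  "eigenvalue A B n = of_nat n * (of_nat (n - 1) * coeff A 2 + coeff B 1)"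

text \<open>
  The degree bounds make the operator triangular on monomials; with distinct diagonal entries there is
  exactly one monic eigenpolynomial in each degree, and every eigenspace is a line.
\<close>

definition admissible :: "complex poly \<Rightarrow> complex poly \<Rightarrow> bool" where
  "admissible A B \<longleftrightarrow> degree A \<le> 2 \<and> degree B \<le> 1 \<and> inj (eigenvalue A B)"

lemma coeff_act_second_order:
  assumes "degree A \<le> 2" "degree B \<le> 1" "\<forall>i>n. coeff p i = 0"
  shows "coeff (p \<cdot> second_order A B) n = eigenvalue A B n * coeff p n"
proof -
  have A: "A = [:coeff A 0, coeff A 1, coeff A 2:]"
    using assms(1) by (intro poly_eqI) (auto simp: coeff_pCons coeff_eq_0 numeral_2_eq_2 split: nat.splits)
  have B: "B = [:coeff B 0, coeff B 1:]"
    using assms(2) by (intro poly_eqI) (auto simp: coeff_pCons coeff_eq_0 split: nat.splits)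
  show ?thesis
    unfolding act_second_order eigenvalue_def
    by (subst A, subst B, cases n rule: nat.exhaust; cases "n - 1")
       (use assms(3) in \<open>auto simp: coeff_pderiv coeff_pCons algebra_simps split: nat.splits\<close>)
qed

definition eigen_family :: "complex poly \<Rightarrow> complex poly \<Rightarrow> (nat \<Rightarrow> complex poly) \<Rightarrow> bool" where
  "eigen_family A B P \<longleftrightarrow> (\<forall>n. degree (P n) = n \<and> lead_coeff (P n) = 1 \<and>
     P n \<cdot> second_order A B = smult (eigenvalue A B n) (P n))"

lemma eigen_familyD:
  assumes "eigen_family A B P"
  shows "degree (P n) = n" "lead_coeff (P n) = 1"
    "P n \<cdot> second_order A B = smult (eigenvalue A B n) (P n)"
  using assms unfolding eigen_family_def by blast+

lemma act_diff_left: "(p - q) \<cdot> D = p \<cdot> D - q \<cdot> D"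
  using act_add_left[of "p - q" q D] by simp

text \<open>
  On polynomials of degree less than \<open>n\<close> the operator minus its \<open>n\<close>-th diagonal entry is triangular with
  nonzero diagonal, hence surjective. So \<open>x\<^sup>n\<close> can be corrected by lower terms to an eigenpolynomial.
\<close>

lemma eigen_family_exists:
  assumes "admissible A B"
  shows "\<exists>P. eigen_family A B P"
proof -
  let ?D = "second_order A B" and ?e = "eigenvalue A B"
  note A = assms[unfolded admissible_def]
  have solve: "\<exists>r. (\<forall>i\<ge>m. coeff r i = 0) \<and> r \<cdot> ?D - smult (?e n) r = q"
    if "m \<le> n" "\<forall>i\<ge>m. coeff q i = 0" for m n q
    using that
  proof (induction m arbitrary: q)
    case 0
    hence "q = 0" by (intro poly_eqI) auto
    thus ?case by (intro exI[of _ 0]) (auto simp: act_def)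
  next
    case (Suc m)
    have ne: "?e m \<noteq> ?e n"
      using A Suc.prems(1) by (auto dest: injD)
    \<comment> \<open>The term that matches the top coefficient of \<open>q\<close>.\<close>
    define r0 where "r0 = monom (coeff q m / (?e m - ?e n)) m"
    have r0: "\<forall>i>k. coeff r0 i = 0" if "k \<ge> m" for k
      using that by (auto simp: r0_def)
    have "\<forall>i\<ge>m. coeff (q - (r0 \<cdot> ?D - smult (?e n) r0)) i = 0"
    proof (intro allI impI)
      fix i assume i: "i \<ge> m"
      have "coeff (r0 \<cdot> ?D) i = ?e i * coeff r0 i"
        using coeff_act_second_order[of A B i r0] r0[OF i] A by auto
      thus "coeff (q - (r0 \<cdot> ?D - smult (?e n) r0)) i = 0"
        using i Suc.prems(2) ne by (cases "i = m") (auto simp: r0_def field_simps)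
    qed
    from Suc.IH[OF _ this] Suc.prems(1) obtain r where
      r: "\<forall>i\<ge>m. coeff r i = 0" "r \<cdot> ?D - smult (?e n) r = q - (r0 \<cdot> ?D - smult (?e n) r0)"
      by auto
    have "\<forall>i\<ge>Suc m. coeff (r + r0) i = 0" using r(1) by (auto simp: r0_def)
    moreover have "(r + r0) \<cdot> ?D - smult (?e n) (r + r0) = q"
      using r(2) by (simp add: act_add_left smult_add_right algebra_simps)
    ultimately show ?case by blast
  qed
  have "\<exists>p. degree p = n \<and> lead_coeff p = 1 \<and> p \<cdot> ?D = smult (?e n) p" for n
  proof -
    let ?x = "monom 1 n :: complex poly"
    have "\<forall>i\<ge>n. coeff (smult (?e n) ?x - ?x \<cdot> ?D) i = 0"
    proof (intro allI impI)
      fix i assume i: "i \<ge> n"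
      have "coeff (?x \<cdot> ?D) i = ?e i * coeff ?x i"
        using coeff_act_second_order[of A B i ?x] i A by auto
      thus "coeff (smult (?e n) ?x - ?x \<cdot> ?D) i = 0" by auto
    qed
    from solve[OF order.refl this] obtain r where
      r: "\<forall>i\<ge>n. coeff r i = 0" "r \<cdot> ?D - smult (?e n) r = smult (?e n) ?x - ?x \<cdot> ?D" by blast
    have deg: "degree (?x + r) = n"
      using r(1) by (intro antisym degree_le le_degree) auto
    moreover have "coeff (?x + r) n = 1" using r(1) by simp
    moreover have "(?x + r) \<cdot> ?D = smult (?e n) (?x + r)"
      using r(2) by (simp add: act_add_left smult_add_right algebra_simps)
    ultimately show ?thesis by metis
  qed
  thus ?thesis unfolding eigen_family_def by metis
qed

text \<open>
  The degree of an eigenpolynomial can be read off its eigenvalue. Subtracting the multiple of \<open>P n\<close> that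
  cancels the coefficient of \<open>x\<^sup>n\<close> therefore leaves nothing.
\<close>

lemma eigenspace:
  assumes adm: "admissible A B" and P: "eigen_family A B P"
    and q: "q \<cdot> second_order A B = smult (eigenvalue A B n) q"
  shows "q = smult (coeff q n) (P n)"
proof -
  have top: "degree r = n" if "r \<cdot> second_order A B = smult (eigenvalue A B n) r" "r \<noteq> 0" for r
  proof -
    have "coeff (r \<cdot> second_order A B) (degree r) = eigenvalue A B (degree r) * lead_coeff r"
      using adm by (intro coeff_act_second_order) (auto simp: admissible_def coeff_eq_0)
    with that have "eigenvalue A B n = eigenvalue A B (degree r)" by simp
    with adm show ?thesis by (auto simp: admissible_def dest: injD)
  qed
  define r where "r = q - smult (coeff q n) (P n)"
  have "r \<cdot> second_order A B = smult (eigenvalue A B n) r"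
    using P q by (simp add: r_def act_diff_left act_smult_left eigen_family_def smult_diff_right mult.commute)
  moreover have "coeff r n = 0"
  proof -
    have "degree (P n) = n" "lead_coeff (P n) = 1"
      using P unfolding eigen_family_def by blast+
    thus ?thesis by (simp add: r_def)
  qed
  ultimately have "r = 0"
    using top[of r] by (metis leading_coeff_0_iff)
  thus ?thesis by (simp add: r_def)
qed

text \<open>
  An intertwiner maps each eigenpolynomial to an eigenvector for the same eigenvalue, hence to a multiple
  of the corresponding eigenpolynomial, since eigenspaces are lines. Conversely, both products have the
  same effect on every \<open>P n\<close>, and these span all polynomials.
\<close>

lemma intertwiner_iff:
  assumes adm: "admissible A2 B2"
    and P: "eigen_family A1 B1 P" and Q: "eigen_family A2 B2 Q"
    and ev: "eigenvalue A1 B1 = eigenvalue A2 B2"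
  shows "(\<exists>\<Lambda>. \<forall>n. P n \<cdot> T = smult (\<Lambda> n) (Q n)) \<longleftrightarrow> second_order A1 B1 * T = T * second_order A2 B2"
proof
  assume "\<exists>\<Lambda>. \<forall>n. P n \<cdot> T = smult (\<Lambda> n) (Q n)"
  then obtain \<Lambda> where L: "P n \<cdot> T = smult (\<Lambda> n) (Q n)" for n by blast
  show "second_order A1 B1 * T = T * second_order A2 B2"
  proof (rule monic_sequence_diff_op_eqI[of P])
    fix n
    have "P n \<cdot> second_order A1 B1 = smult (eigenvalue A2 B2 n) (P n)"
      "Q n \<cdot> second_order A2 B2 = smult (eigenvalue A2 B2 n) (Q n)"
      using P Q by (simp_all add: eigen_family_def ev)
    thus "P n \<cdot> (second_order A1 B1 * T) = P n \<cdot> (T * second_order A2 B2)"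
      by (simp add: act_times act_smult_left L mult.commute)
  qed (rule eigen_familyD[OF P])+
next
  assume T: "second_order A1 B1 * T = T * second_order A2 B2"
  have "(P n \<cdot> T) \<cdot> second_order A2 B2 = smult (eigenvalue A2 B2 n) (P n \<cdot> T)" for n
  proof -
    have "(P n \<cdot> T) \<cdot> second_order A2 B2 = P n \<cdot> (second_order A1 B1 * T)"
      unfolding T by (simp add: act_times)
    also have "\<dots> = smult (eigenvalue A2 B2 n) (P n \<cdot> T)"
      using P by (simp only: eigen_family_def act_times act_smult_left ev)
    finally show ?thesis .
  qed
  from eigenspace[OF adm Q this] have "\<forall>n. P n \<cdot> T = smult (coeff (P n \<cdot> T) n) (Q n)"
    by blast
  thus "\<exists>\<Lambda>. \<forall>n. P n \<cdot> T = smult (\<Lambda> n) (Q n)"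
    by (intro exI[of _ "\<lambda>n. coeff (P n \<cdot> T) n"])
qed

section \<open>Degrees of the coefficients of degree-nonincreasing operators\<close>

lemma degree_funpow_pderiv: "degree ((pderiv ^^ i) (p :: complex poly)) \<le> degree p - i"
proof (induction i)
  case (Suc i)
  have "degree ((pderiv ^^ Suc i) p) = degree ((pderiv ^^ i) p) - 1"
    by (simp add: degree_pderiv)
  also have "\<dots> \<le> degree p - Suc i"
    using Suc by simp
  finally show ?case .
qed simp

text \<open>
  The action on \<open>x\<^sup>n\<close> involves only the coefficients up to index \<open>n\<close>, and the last one appears with the nonzero
  factor \<open>n!\<close>.
\<close>

lemma degree_coeff_op_le:
  assumes "\<And>n. degree (monom 1 n \<cdot> T) \<le> n"
  shows "degree (coeff_op T n) \<le> n"
proof (induction n rule: less_induct)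
  case (less n)
  let ?x = "monom 1 n :: complex poly" and ?F = "op_coeffs T"
  define N where "N = max n (degree ?F)"
  have "?x \<cdot> T = (\<Sum>j\<le>N. (pderiv ^^ j) ?x * coeff ?F j)"
    unfolding act_def by (rule raw_act_bound) (simp add: N_def)
  also have "\<dots> = (\<Sum>j\<le>n. (pderiv ^^ j) ?x * coeff ?F j)"
    by (intro sum.mono_neutral_right) (auto simp: N_def funpow_pderiv_monom_less)
  also have "\<dots> = (\<Sum>j<n. (pderiv ^^ j) ?x * coeff ?F j) + smult (fact n) (coeff ?F n)"
    by (simp add: lessThan_Suc_atMost[symmetric] funpow_pderiv_monom_self)
  finally have eq: "smult (fact n) (coeff ?F n) = ?x \<cdot> T - (\<Sum>j<n. (pderiv ^^ j) ?x * coeff ?F j)"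
    by simp
  have "degree ((pderiv ^^ j) ?x * coeff ?F j) \<le> n" if "j < n" for j
  proof -
    have "degree ((pderiv ^^ j) ?x) \<le> n - j"
      using degree_funpow_pderiv[of j ?x] by (simp add: degree_monom_eq)
    moreover have "degree (coeff ?F j) \<le> j"
      using less that by simp
    ultimately show ?thesis
      using that degree_mult_le[of "(pderiv ^^ j) ?x" "coeff ?F j"] by linarith
  qed
  hence "degree (\<Sum>j<n. (pderiv ^^ j) ?x * coeff ?F j) \<le> n"
    by (intro degree_sum_le) auto
  hence "degree (smult (fact n) (coeff ?F n)) \<le> n"
    unfolding eq using assms by (intro degree_diff_le)
  thus ?case by simp
qed

lemma degree_act_le:
  assumes P: "\<And>n. degree (P n) = n" "\<And>n. lead_coeff (P n) = 1"
    and PT: "\<And>n. degree (P n \<cdot> T) \<le> n"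
  shows "degree (p \<cdot> T) \<le> degree p"
proof (rule monic_sequence_induct[OF P, where p = p and m = "Suc (degree p)"
      and R = "\<lambda>q. degree (q \<cdot> T) \<le> degree p"])
  show "degree (0 \<cdot> T) \<le> degree p"
    by (simp add: act_def)
next
  fix n c r
  assume n: "n < Suc (degree p)" and r: "degree (r \<cdot> T) \<le> degree p"
  have "degree (smult c (P n \<cdot> T)) \<le> degree p"
    using PT[of n] n degree_smult_le[of c "P n \<cdot> T"] by linarith
  thus "degree ((smult c (P n) + r) \<cdot> T) \<le> degree p"
    using r by (simp add: act_add_left act_smult_left degree_add_le)
qed (auto simp: coeff_eq_0)

section \<open>Operators between weights with different eigenvalues\<close>

lemma funpow_pderiv_act_second_order:
  assumes "degree A \<le> 2" "degree B \<le> 1"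
  shows "(pderiv ^^ j) (p \<cdot> second_order A B) =
           (pderiv ^^ (j + 2)) p * A + (pderiv ^^ (j + 1)) p * (B + of_nat j * pderiv A) +
           (pderiv ^^ j) p * (of_nat j * pderiv B + of_nat (j choose 2) * pderiv (pderiv A))"
proof (induction j)
  case 0
  show ?case by (simp add: act_second_order)
next
  case (Suc j)
  have B: "pderiv (pderiv B) = 0" and A: "pderiv (pderiv (pderiv A)) = 0"
    using assms by (simp_all add: pderiv_eq_0_iff degree_pderiv)
  show ?case
    by (simp only: funpow.simps o_apply Suc)
       (simp add: pderiv_add pderiv_mult A B numeral_2_eq_2 algebra_simps)
qed

text \<open>
  Differentiate the eigenvalue equation \<open>j\<close> times and evaluate it at a zero \<open>\<xi>\<close> of \<open>A\<close>: the term of highest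
  order drops out, and what remains is a two-term recursion for the Taylor coefficients at \<open>\<xi>\<close>. They
  are thus \<open>p(\<xi>)\<close> times polynomials in the eigenvalue which do not depend on \<open>p\<close>.
\<close>

lemma eigenpoly_taylor:
  assumes deg: "degree A \<le> 2" "degree B \<le> 1" and A: "poly A \<xi> = 0"
    and B: "\<And>j. poly (B + of_nat j * pderiv A) \<xi> \<noteq> 0"
  shows "\<exists>Q. \<forall>l p. p \<cdot> second_order A B = smult l p \<longrightarrow>
           poly ((pderiv ^^ j) p) \<xi> = poly Q l * poly p \<xi>"
proof (induction j)
  case 0
  show ?case by (intro exI[of _ 1]) simp
next
  case (Suc j)
  then obtain Q where Q: "\<And>l p. p \<cdot> second_order A B = smult l p \<Longrightarrow>
           poly ((pderiv ^^ j) p) \<xi> = poly Q l * poly p \<xi>" by blast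
  define b where "b = poly (B + of_nat j * pderiv A) \<xi>"
  define c where "c = poly (of_nat j * pderiv B + of_nat (j choose 2) * pderiv (pderiv A)) \<xi>"
  have "poly ((pderiv ^^ Suc j) p) \<xi> = poly (smult (1 / b) ([:-c, 1:] * Q)) l * poly p \<xi>"
    if eig: "p \<cdot> second_order A B = smult l p" for l p
  proof -
    have "(pderiv ^^ j) (smult l p) = smult l ((pderiv ^^ j) p)"
      by (induction j) (auto simp: pderiv_smult)
    with funpow_pderiv_act_second_order[OF deg, of j p] eig
    have "smult l ((pderiv ^^ j) p) =
           (pderiv ^^ (j + 2)) p * A + (pderiv ^^ (j + 1)) p * (B + of_nat j * pderiv A) +
           (pderiv ^^ j) p * (of_nat j * pderiv B + of_nat (j choose 2) * pderiv (pderiv A))"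
      by simp
    from arg_cong[OF this, of "\<lambda>q. poly q \<xi>"]
    have "l * poly ((pderiv ^^ j) p) \<xi> = poly ((pderiv ^^ Suc j) p) \<xi> * b + poly ((pderiv ^^ j) p) \<xi> * c"
      by (simp only: b_def c_def poly_add poly_mult[of "(pderiv ^^ _) p"] poly_smult A) simp
    hence "b * poly ((pderiv ^^ Suc j) p) \<xi> = (l - c) * (poly Q l * poly p \<xi>)"
      unfolding Q[OF eig] by (simp add: algebra_simps)
    moreover have "b \<noteq> 0" using B by (simp add: b_def)
    ultimately show ?thesis by (simp add: field_simps)
  qed
  thus ?case by blast
qed

lemma eigenpoly_act_taylor:
  assumes deg: "degree A \<le> 2" "degree B \<le> 1" and A: "poly A \<xi> = 0"
    and B: "\<And>j. poly (B + of_nat j * pderiv A) \<xi> \<noteq> 0"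
  shows "\<exists>R. \<forall>l p. p \<cdot> second_order A B = smult l p \<longrightarrow> poly (p \<cdot> T) \<xi> = poly R l * poly p \<xi>"
proof -
  from eigenpoly_taylor[OF assms] obtain Q where Q: "\<And>j l p. p \<cdot> second_order A B = smult l p \<Longrightarrow>
           poly ((pderiv ^^ j) p) \<xi> = poly (Q j) l * poly p \<xi>" by metis
  let ?F = "op_coeffs T"
  have "poly (p \<cdot> T) \<xi> = poly (\<Sum>j\<le>degree ?F. smult (poly (coeff ?F j) \<xi>) (Q j)) l * poly p \<xi>"
    if "p \<cdot> second_order A B = smult l p" for l p
    unfolding act_def raw_act_def
    by (simp add: poly_sum Q[OF that] sum_distrib_left mult_ac)
  thus ?thesis by blast
qed

lemma eigenpoly_eq_0:
  assumes deg: "degree A \<le> 2" "degree B \<le> 1" and A: "poly A \<xi> = 0"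
    and B: "\<And>j. poly (B + of_nat j * pderiv A) \<xi> \<noteq> 0"
    and p: "p \<cdot> second_order A B = smult l p" "poly p \<xi> = 0"
  shows "p = 0"
proof (rule ccontr)
  assume "p \<noteq> 0"
  have "poly ((pderiv ^^ j) p) \<xi> = 0" for j
    using eigenpoly_taylor[OF deg A B, of j] p by auto
  hence zero: "poly ((pderiv ^^ j) p) \<xi> = 0" for j .
  have const: "degree ((pderiv ^^ j) p) = degree p - j" for j
    by (induction j) (auto simp: degree_pderiv)
  have nz: "(pderiv ^^ j) p \<noteq> 0" if "j \<le> degree p" for j
    using that
  proof (induction j)
    case (Suc j)
    thus ?case using const[of j] by (auto simp: pderiv_eq_0_iff)
  qed (use \<open>p \<noteq> 0\<close> in auto)
  obtain c where "(pderiv ^^ degree p) p = [:c:]"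
    using const[of "degree p"] by (auto elim: degree_eq_zeroE)
  with zero[of "degree p"] nz[of "degree p"] show False by simp
qed

text \<open>
  A nonzero polynomial in a quadratic polynomial \<open>L\<close> has even degree, and multiplication by the variable makes
  the degree odd.
\<close>

lemma odd_not_even_in_quadratic:
  fixes R U L :: "complex poly"
  assumes L: "degree L = 2" and d: "d \<noteq> 0"
    and eq: "\<And>n. of_nat n * d * poly R (poly L (of_nat n)) = poly U (poly L (of_nat n))"
  shows "R = 0"
proof (rule ccontr)
  assume "R \<noteq> 0"
  let ?X = "[:0, d:] * pcompose R L" and ?Y = "pcompose U L"
  have "?X - ?Y = 0"
  proof (rule ccontr)
    assume "?X - ?Y \<noteq> 0"
    hence "finite {x. poly (?X - ?Y) x = 0}" by (rule poly_roots_finite)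
    moreover have "range of_nat \<subseteq> {x. poly (?X - ?Y) x = 0}"
      using eq by (auto simp: poly_pcompose mult.assoc)
    ultimately have "finite (range (of_nat :: nat \<Rightarrow> complex))"
      by (rule rev_finite_subset)
    thus False
      using finite_imageD[of "of_nat :: nat \<Rightarrow> complex" UNIV] by (simp add: inj_of_nat)
  qed
  hence XY: "?X = ?Y" by simp
  have "pcompose R L \<noteq> 0"
    using \<open>R \<noteq> 0\<close> L by (simp add: pcompose_eq_0_iff)
  hence "degree ?X = 1 + degree R * 2"
    using d L by (subst degree_mult_eq) (auto simp: degree_pcompose)
  moreover have "degree ?Y = degree U * 2"
    using L by (simp add: degree_pcompose)
  ultimately have "1 + degree R * 2 = degree U * 2"
    unfolding XY by linarith
  thus False by presburger
qed

text \<open>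
  For Jacobi weights with different parameter sums. By the Taylor expansion at the singular point \<open>\<xi>\<close>, the
  value and the derivative of \<open>P n \<cdot> T\<close> at \<open>\<xi>\<close> are \<open>P n (\<xi>)\<close> times polynomials \<open>R\<close> and \<open>S\<close> in the eigenvalue of
  \<open>P n\<close>. Being a multiple of \<open>Q n\<close>, the image also satisfies the second eigenvalue equation, which at \<open>\<xi>\<close> relates
  value and derivative through the eigenvalue of \<open>Q n\<close>. The two eigenvalues differ by a multiple of \<open>n\<close>, so
  \<open>n R\<close> is a polynomial in the quadratic eigenvalue; parity forces \<open>R = 0\<close>. An eigenpolynomial that vanishes
  at \<open>\<xi>\<close> is zero, hence \<open>T\<close> kills every \<open>P n\<close>.
\<close>

lemma op_space_eq_0_if_spectra_differ:
  assumes deg: "degree A \<le> 2" "degree B1 \<le> 1" "degree B2 \<le> 1" and A: "poly A \<xi> = 0" "coeff A 2 \<noteq> 0"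
    and B1: "\<And>j. poly (B1 + of_nat j * pderiv A) \<xi> \<noteq> 0"
    and B2: "\<And>j. poly (B2 + of_nat j * pderiv A) \<xi> \<noteq> 0"
    and ne: "coeff B1 1 \<noteq> coeff B2 1"
    and P: "eigen_family A B1 P" and Q: "eigen_family A B2 Q"
    and T: "\<And>n. P n \<cdot> T = smult (\<Lambda> n) (Q n)"
  shows "T = 0"
proof -
  let ?ev = "eigenvalue A B1" and ?mu = "eigenvalue A B2"
  obtain R where R: "\<And>l p. p \<cdot> second_order A B1 = smult l p \<Longrightarrow> poly (p \<cdot> T) \<xi> = poly R l * poly p \<xi>"
    using eigenpoly_act_taylor[OF deg(1,2) A(1) B1, of T] by blast
  obtain S where S: "\<And>l p. p \<cdot> second_order A B1 = smult l p \<Longrightarrow>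
      poly (p \<cdot> (T * \<partial>)) \<xi> = poly S l * poly p \<xi>"
    using eigenpoly_act_taylor[OF deg(1,2) A(1) B1, of "T * \<partial>"] by blast
  note P' = eigen_familyD[OF P]
  have Peig: "(P n \<cdot> T) \<cdot> second_order A B2 = smult (?mu n) (P n \<cdot> T)" for n
    by (simp add: T act_smult_left eigen_familyD[OF Q] mult.commute)
  have P0: "poly (P n) \<xi> \<noteq> 0" for n
    using eigenpoly_eq_0[OF deg(1,2) A(1) B1 P'(3)[of n]] P'(2)[of n] by auto
  \<comment> \<open>At \<open>\<xi>\<close> the second eigenvalue equation reads \<open>B2 q' = \<mu> q\<close>, since \<open>A\<close> vanishes there.\<close>
  have rel: "poly B2 \<xi> * poly S (?ev n) = ?mu n * poly R (?ev n)" for n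
  proof -
    from arg_cong[OF Peig[of n], of "\<lambda>q. poly q \<xi>"]
    have "poly B2 \<xi> * poly (pderiv (P n \<cdot> T)) \<xi> = ?mu n * poly (P n \<cdot> T) \<xi>"
      by (simp add: act_second_order A mult.commute)
    also have "pderiv (P n \<cdot> T) = P n \<cdot> (T * \<partial>)"
      by (simp add: act_times act_partial)
    finally have "(poly B2 \<xi> * poly S (?ev n)) * poly (P n) \<xi> = (?mu n * poly R (?ev n)) * poly (P n) \<xi>"
      by (simp only: R[OF P'(3)] S[OF P'(3)] mult.assoc)
    thus ?thesis using P0[of n] by simp
  qed
  \<comment> \<open>The first eigenvalue as a quadratic polynomial in the index.\<close>
  define L where "L = [:0, coeff B1 1 - coeff A 2, coeff A 2:]"
  have L: "poly L (of_nat n) = ?ev n" for n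
    by (cases n) (simp_all add: L_def eigenvalue_def algebra_simps)
  define d where "d = coeff B2 1 - coeff B1 1"
  have mu: "?mu n = ?ev n + of_nat n * d" for n
    by (simp add: eigenvalue_def d_def algebra_simps)
  have "of_nat n * d * poly R (poly L (of_nat n)) =
      poly (smult (poly B2 \<xi>) S - [:0, 1:] * R) (poly L (of_nat n))" for n
    using rel[of n] unfolding L mu by (simp add: algebra_simps)
  moreover have "degree L = 2" "d \<noteq> 0"
    using A ne by (auto simp: L_def d_def)
  ultimately have "R = 0"
    using odd_not_even_in_quadratic by blast
  hence "poly (P n \<cdot> T) \<xi> = 0" for n
    using R[OF P'(3)] by simp
  hence "P n \<cdot> T = 0" for n
    using eigenpoly_eq_0[OF deg(1,3) A(1) B2 Peig] by blast
  thus "T = 0"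
    by (intro monic_sequence_diff_op_eqI[of P]) (simp_all add: act_zero P'(1) P'(2)[unfolded P'(1)])
qed

section \<open>Weights with a Pearson equation\<close>

abbreviation cpoly :: "real poly \<Rightarrow> complex poly" where
  "cpoly \<equiv> map_poly complex_of_real"

abbreviation poly_cnj :: "complex poly \<Rightarrow> complex poly" where
  "poly_cnj \<equiv> map_poly cnj"

definition moment :: "weight \<Rightarrow> complex poly \<Rightarrow> complex" where
  "moment w p = (LINT x:interval w|lborel. complex_of_real (weight.density w x) * poly p (complex_of_real x))"

lemma weight_inner_eq_moment: "weight_inner w p q = moment w (p * poly_cnj q)"
proof -
  have "poly (poly_cnj q) (complex_of_real x) = cnj (poly q (complex_of_real x))" for x
    by (simp only: poly_cnj complex_cnj_complex_of_real)
  thus ?thesis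
    by (simp add: weight_inner_def moment_def mult.assoc)
qed

lemma poly_cpoly: "poly (cpoly p) (complex_of_real x) = of_real (poly p x)"
  by (induction p) (auto simp: map_poly_pCons)

text \<open>
  The function \<open>\<omega>\<close> is the density without the cutoff outside the interval, so that it can be differentiated.
  The Pearson equation \<open>(A \<omega>)' = B \<omega>\<close> together with the vanishing of \<open>A \<omega> x\<^sup>k\<close> at the end points is what makes
  the operator with coefficients \<open>A\<close> and \<open>B\<close> symmetric for the inner product of the weight.
\<close>

locale pearson_weight =
  fixes w :: weight and a b :: ereal and \<omega> :: "real \<Rightarrow> real" and A B :: "real poly"
  assumes ab: "a < b" and interval: "interval w = einterval a b"
    and density: "\<And>x. x \<in> einterval a b \<Longrightarrow> weight.density w x = \<omega> x"
    and pos: "\<And>x. x \<in> einterval a b \<Longrightarrow> \<omega> x > 0"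
    and cont: "\<And>x. x \<in> einterval a b \<Longrightarrow> isCont \<omega> x"
    and pearson: "\<And>x. x \<in> einterval a b \<Longrightarrow>
      ((\<lambda>x. \<omega> x * poly A x) has_real_derivative \<omega> x * poly B x) (at x)"
    and integrable: "\<And>k. set_integrable lborel (einterval a b) (\<lambda>x. \<omega> x * x ^ k)"
    and limit_a: "\<And>k. (((\<lambda>x. \<omega> x * poly A x * x ^ k) \<circ> real_of_ereal) \<longlongrightarrow> 0) (at_right a)"
    and limit_b: "\<And>k. (((\<lambda>x. \<omega> x * poly A x * x ^ k) \<circ> real_of_ereal) \<longlongrightarrow> 0) (at_left b)"
    and admissible: "admissible (cpoly A) (cpoly B)"
begin

lemma poly_integrable:
  "set_integrable lborel (einterval a b) (\<lambda>x. complex_of_real (\<omega> x) * poly p (complex_of_real x))"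
proof -
  have "set_integrable lborel (einterval a b) (\<lambda>x. complex_of_real (\<omega> x * x ^ k))" for k
    using integrable_of_real[OF integrable[of k, unfolded set_integrable_def], where 'a = complex]
    by (simp add: set_integrable_def scaleR_conv_of_real)
  hence "set_integrable lborel (einterval a b) (\<lambda>x. coeff p k * complex_of_real (\<omega> x * x ^ k))" for k
    by (intro set_integrable_mult_right)
  hence "set_integrable lborel (einterval a b) (\<lambda>x. \<Sum>k\<le>degree p. coeff p k * complex_of_real (\<omega> x * x ^ k))"
    unfolding set_integrable_def scaleR_sum_right by (intro Bochner_Integration.integrable_sum)
  thus ?thesis
    by (simp add: poly_altdef sum_distrib_left mult_ac)
qed

lemma moment_eq:
  "moment w p = (LINT x:einterval a b|lborel. complex_of_real (\<omega> x) * poly p (complex_of_real x))"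
  unfolding moment_def interval
  by (rule set_lebesgue_integral_cong) (auto simp: density)

lemma moment_add: "moment w (p + q) = moment w p + moment w q"
  unfolding moment_eq
  using set_integral_add(2)[OF poly_integrable[of p] poly_integrable[of q]]
  by (simp add: algebra_simps)

lemma moment_smult: "moment w (smult c p) = c * moment w p"
  unfolding moment_eq
  using set_integral_mult_right[of lborel "einterval a b" c "\<lambda>x. complex_of_real (\<omega> x) * poly p (complex_of_real x)"]
  by (simp add: mult.left_commute)

text \<open>
  The integrand is the derivative of \<open>\<omega> A p\<close>, which vanishes at both ends.
\<close>

lemma moment_pearson: "moment w (p * cpoly B + pderiv p * cpoly A) = 0"
proof -
  let ?F = "\<lambda>x. complex_of_real (\<omega> x * poly A x) * poly p (complex_of_real x)"
  let ?f = "\<lambda>x. complex_of_real (\<omega> x) * poly (p * cpoly B + pderiv p * cpoly A) (complex_of_real x)"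
  have lim: "((?F \<circ> real_of_ereal) \<longlongrightarrow> 0) G"
    if "\<And>k. (((\<lambda>x. \<omega> x * poly A x * x ^ k) \<circ> real_of_ereal) \<longlongrightarrow> 0) G" for G
  proof -
    have "((\<lambda>x. \<Sum>k\<le>degree p. coeff p k *
        complex_of_real (((\<lambda>x. \<omega> x * poly A x * x ^ k) \<circ> real_of_ereal) x)) \<longlongrightarrow>
        (\<Sum>k\<le>degree p. coeff p k * complex_of_real 0)) G"
      by (intro tendsto_intros that)
    thus ?thesis
      by (simp add: poly_altdef[of p] sum_distrib_left mult_ac o_def)
  qed
  have "(LBINT x=a..b. ?f x) = 0 - 0"
  proof (rule interval_integral_FTC_integrable)
    fix x assume "a < ereal x" "ereal x < b"
    hence x: "x \<in> einterval a b" by (simp add: einterval_iff)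
    have "((\<lambda>x. complex_of_real (\<omega> x * poly A x)) has_vector_derivative complex_of_real (\<omega> x * poly B x)) (at x)"
      by (rule has_vector_derivative_of_real[OF pearson[OF x]])
    moreover have "((\<lambda>x. poly p (complex_of_real x)) has_vector_derivative poly (pderiv p) (complex_of_real x)) (at x)"
      by (rule has_vector_derivative_real_field[where f = "poly p"]) (rule poly_DERIV)
    ultimately have "(?F has_vector_derivative complex_of_real (\<omega> x * poly A x) * poly (pderiv p) (complex_of_real x) +
        complex_of_real (\<omega> x * poly B x) * poly p (complex_of_real x)) (at x)"
      by (rule has_vector_derivative_mult)
    thus "(?F has_vector_derivative ?f x) (at x)"
      by (simp add: poly_cpoly algebra_simps)
    show "isCont ?f x"
      by (intro continuous_intros cont[OF x])
  qed (rule ab poly_integrable lim limit_a limit_b)+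
  thus ?thesis
    using less_imp_le[OF ab] unfolding moment_eq interval_lebesgue_integral_def by simp
qed

text \<open>
  Integration by parts turns \<open>\<integral>(p \<cdot> \<delta>) q \<omega>\<close> into \<open>-\<integral>A p' q' \<omega>\<close>, which is symmetric in \<open>p\<close> and \<open>q\<close>.
\<close>

lemma moment_symmetric:
  "moment w (p \<cdot> second_order (cpoly A) (cpoly B) * q) =
   moment w (p * (q \<cdot> second_order (cpoly A) (cpoly B)))"
proof -
  have *: "moment w (p \<cdot> second_order (cpoly A) (cpoly B) * q) = - moment w (pderiv p * pderiv q * cpoly A)" for p q
  proof -
    have "p \<cdot> second_order (cpoly A) (cpoly B) * q + pderiv p * pderiv q * cpoly A =
        (pderiv p * q) * cpoly B + pderiv (pderiv p * q) * cpoly A"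
      by (simp add: act_second_order pderiv_mult algebra_simps)
    hence "moment w (p \<cdot> second_order (cpoly A) (cpoly B) * q + pderiv p * pderiv q * cpoly A) = 0"
      by (simp only: moment_pearson)
    thus ?thesis
      by (simp add: moment_add eq_neg_iff_add_eq_0)
  qed
  show ?thesis
    using *[of p q] *[of q p] by (simp add: mult_ac)
qed

text \<open>
  If the integral of \<open>\<omega> |p|\<^sup>2\<close> vanishes, then \<open>p\<close> is zero almost everywhere on an interval of positive length, which
  contains infinitely many points.
\<close>

lemma moment_square_eq_0:
  assumes "moment w (p * poly_cnj p) = 0"
  shows "p = 0"
proof (rule ccontr)
  assume p: "p \<noteq> 0"
  let ?I = "einterval a b"
  let ?g = "\<lambda>x. \<omega> x * (cmod (poly p (complex_of_real x)))\<^sup>2"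
  have eq: "complex_of_real (\<omega> x) * poly (p * poly_cnj p) (complex_of_real x) = complex_of_real (?g x)" for x
    using poly_cnj[of p "complex_of_real x"]
    by (simp add: complex_norm_square[symmetric] del: of_real_power) 
  have "set_integrable lborel ?I (\<lambda>x. complex_of_real (?g x))"
    using poly_integrable[of "p * poly_cnj p"] by (simp only: eq)
  hence int: "integrable lborel (\<lambda>x. indicator ?I x * ?g x)"
    unfolding set_integrable_def scaleR_conv_of_real of_real_mult[symmetric]
    using integrable_Re by fastforce
  have "(LINT x:?I|lborel. complex_of_real (?g x)) = 0"
    using assms unfolding moment_eq eq .
  hence "(\<integral>x. indicator ?I x * ?g x \<partial>lborel) = 0"
    by (simp only: set_integral_complex_of_real of_real_eq_0_iff) (simp add: set_lebesgue_integral_def)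
  hence "AE x in lborel. indicator ?I x * ?g x = 0"
    by (subst (asm) integral_nonneg_eq_0_iff_AE[OF int])
       (auto simp: indicator_def intro!: AE_I2 mult_nonneg_nonneg less_imp_le[OF pos])
  hence "AE x in lborel. x \<notin> ?I \<or> poly p (complex_of_real x) = 0"
  proof eventually_elim
    case (elim x)
    thus ?case using pos[of x] by (auto simp: indicator_def)
  qed
  moreover have "AE x in lborel. poly p (complex_of_real x) \<noteq> 0"
  proof -
    have "finite (complex_of_real -` {z. poly p z = 0})"
      using p by (intro finite_vimageI poly_roots_finite) (auto simp: inj_on_def)
    hence "complex_of_real -` {z. poly p z = 0} \<in> null_sets lborel"
      by (rule finite_imp_null_set_lborel)
    from AE_not_in[OF this] show ?thesis by simp
  qed
  ultimately have "AE x in lborel. x \<notin> ?I"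
    by eventually_elim auto
  hence "?I \<in> null_sets lborel"
    using AE_iff_null_sets[of ?I lborel] by simp
  moreover obtain c where "c \<in> ?I"
    using einterval_nonempty[OF ab] by blast
  then obtain e where e: "e > 0" "{c - e <..< c + e} \<subseteq> ?I"
    using open_einterval[of a b] unfolding open_contains_ball ball_eq_greaterThanLessThan by blast
  ultimately have "{c - e <..< c + e} \<in> null_sets lborel"
    using null_sets_subset[of ?I lborel "{c - e <..< c + e}"] by simp
  with e(1) show False
    by (simp add: null_sets_def)
qed

lemma monic_orthogonalD:
  assumes "monic_orthogonal w P"
  shows "degree (P n) = n" "lead_coeff (P n) = 1" "m \<noteq> n \<Longrightarrow> weight_inner w (P m) (P n) = 0"
  using assms unfolding monic_orthogonal_def by blast+

lemma orthogonal_lower: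
  assumes P: "monic_orthogonal w P" and p: "\<forall>i\<ge>n. coeff p i = 0"
  shows "weight_inner w (P n) p = 0"
proof (rule monic_sequence_induct[of P n p])
  show "weight_inner w (P n) 0 = 0"
    using moment_smult[of 0 1] by (simp add: weight_inner_eq_moment)
next
  fix m c r assume m: "m < n" and r: "weight_inner w (P n) r = 0"
  have "poly_cnj (smult c (P m) + r) = smult (cnj c) (poly_cnj (P m)) + poly_cnj r"
    by (intro poly_eqI) (simp add: coeff_map_poly)
  hence "weight_inner w (P n) (smult c (P m) + r) = cnj c * weight_inner w (P n) (P m) + weight_inner w (P n) r"
    by (simp add: weight_inner_eq_moment algebra_simps moment_add moment_smult)
  also have "\<dots> = 0"
    using monic_orthogonalD(3)[OF P, of n m] m r by simp
  finally show "weight_inner w (P n) (smult c (P m) + r) = 0" .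
qed (rule monic_orthogonalD(1,2)[OF P] p)+

text \<open>
  The difference of the two members of degree \<open>n\<close> has lower degree, so it is orthogonal to both of them and
  hence to itself.
\<close>

lemma monic_orthogonal_unique:
  assumes P: "monic_orthogonal w P" and Q: "monic_orthogonal w Q"
  shows "P = Q"
proof
  fix n
  let ?d = "P n - Q n"
  have deg: "degree (P n) = n" "coeff (P n) n = 1" "degree (Q n) = n" "coeff (Q n) n = 1"
    using monic_orthogonalD(1,2)[OF P, of n] monic_orthogonalD(1,2)[OF Q, of n] by simp_all
  have low: "\<forall>i\<ge>n. coeff ?d i = 0"
  proof (intro allI impI)
    fix i assume "i \<ge> n"
    thus "coeff ?d i = 0" using deg by (cases "i = n") (auto simp: coeff_eq_0)
  qed
  have "weight_inner w ?d ?d = weight_inner w (P n) ?d + (- 1) * weight_inner w (Q n) ?d"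
    by (simp only: weight_inner_eq_moment moment_add[symmetric] moment_smult[symmetric])
       (simp add: algebra_simps)
  also have "\<dots> = 0"
    using orthogonal_lower[OF P low] orthogonal_lower[OF Q low] by simp
  finally have "?d = 0"
    unfolding weight_inner_eq_moment by (rule moment_square_eq_0)
  thus "P n = Q n" by simp
qed

text \<open>
  Eigenvectors of a symmetric operator for distinct eigenvalues are orthogonal. Conjugation of the second
  argument is harmless because \<open>A\<close>, \<open>B\<close> and the eigenvalues are real.
\<close>

lemma eigen_family_orthogonal:
  assumes P: "eigen_family (cpoly A) (cpoly B) P"
  shows "monic_orthogonal w P"
  unfolding monic_orthogonal_def
proof (intro conjI allI impI)
  let ?e = "eigenvalue (cpoly A) (cpoly B)" and ?D = "second_order (cpoly A) (cpoly B)"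
  fix m n :: nat assume "m \<noteq> n"
  hence ne: "?e m \<noteq> ?e n"
    using admissible by (auto simp: admissible_def dest: injD)
  have der: "pderiv (poly_cnj p) = poly_cnj (pderiv p)" for p
    by (intro poly_eqI) (simp add: coeff_map_poly coeff_pderiv)
  have mul: "poly_cnj p * cpoly r = poly_cnj (p * cpoly r)" for p r
    by (intro poly_eqI) (simp add: coeff_map_poly coeff_mult)
  have "poly_cnj (P n) \<cdot> ?D = poly_cnj (P n \<cdot> ?D)"
  proof -
    have add: "poly_cnj (p + q) = poly_cnj p + poly_cnj q" for p q
      by (intro poly_eqI) (simp add: coeff_map_poly)
    show ?thesis by (simp only: act_second_order der mul add)
  qed
  also have "\<dots> = smult (?e n) (poly_cnj (P n))"
  proof -
    have "cnj (?e n) = ?e n"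
      by (simp add: eigenvalue_def coeff_map_poly)
    thus ?thesis
      unfolding eigen_familyD(3)[OF P] by (intro poly_eqI) (simp add: coeff_map_poly)
  qed
  finally have "?e n * weight_inner w (P m) (P n) = moment w (P m * (poly_cnj (P n) \<cdot> ?D))"
    by (simp add: weight_inner_eq_moment moment_smult)
  also have "\<dots> = moment w (P m \<cdot> ?D * poly_cnj (P n))"
    by (simp only: moment_symmetric)
  also have "\<dots> = ?e m * weight_inner w (P m) (P n)"
    by (simp add: weight_inner_eq_moment moment_smult eigen_familyD(3)[OF P])
  finally show "weight_inner w (P m) (P n) = 0"
    using ne by simp
qed (rule eigen_familyD[OF P])+

theorem eigen_family_monic_op: "eigen_family (cpoly A) (cpoly B) (monic_op w)"
proof -
  obtain P where P: "eigen_family (cpoly A) (cpoly B) P"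
    using eigen_family_exists[OF admissible] by blast
  hence "monic_op w = P"
    unfolding monic_op_def using eigen_family_orthogonal monic_orthogonal_unique
    by (intro the_equality) auto
  with P show ?thesis by simp
qed

end

section \<open>Moments and boundary values of the classical densities\<close>

lemma normal_limit_top: "((\<lambda>x::real. exp (- x\<^sup>2 + 2 * b * x) * x ^ k) \<longlongrightarrow> 0) at_top"
proof -
  have "((\<lambda>x::real. exp (- x\<^sup>2 + 2 * b * x) * x powr k) \<longlongrightarrow> 0) at_top"
    by real_asymp
  moreover have "eventually (\<lambda>x::real. exp (- x\<^sup>2 + 2 * b * x) * x powr k = exp (- x\<^sup>2 + 2 * b * x) * x ^ k) at_top"
    using eventually_gt_at_top[of 0] by eventually_elim (simp add: powr_realpow)
  ultimately show ?thesis
    by (rule Lim_transform_eventually)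
qed

lemma normal_limit_bot: "((\<lambda>x::real. exp (- x\<^sup>2 + 2 * b * x) * x ^ k) \<longlongrightarrow> 0) at_bot"
proof -
  have "((\<lambda>x. (- 1) ^ k * (exp (- x\<^sup>2 + 2 * (- b) * x) * x ^ k)) \<longlongrightarrow> (- 1) ^ k * 0) at_top"
    by (intro tendsto_mult tendsto_const normal_limit_top)
  also have "(\<lambda>x. (- 1) ^ k * (exp (- x\<^sup>2 + 2 * (- b) * x) * x ^ k)) =
      (\<lambda>x. exp (- (- x)\<^sup>2 + 2 * b * (- x)) * (- x) ^ k)"
  proof
    fix x :: real
    show "(- 1) ^ k * (exp (- x\<^sup>2 + 2 * (- b) * x) * x ^ k) = exp (- (- x)\<^sup>2 + 2 * b * (- x)) * (- x) ^ k"
      by (subst power_minus[of x k]) simp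
  qed
  finally show ?thesis
    unfolding filterlim_at_bot_mirror mult_zero_right .
qed

text \<open>
  Up to a constant factor the weight is the Gaussian density with mean \<open>b\<close> and variance \<open>1/2\<close>, whose centred
  moments are known.
\<close>

lemma normal_integrable: "integrable lborel (\<lambda>x::real. exp (- x\<^sup>2 + 2 * b * x) * x ^ k)"
proof -
  have "integrable lborel (\<lambda>x. normal_density b (1 / sqrt 2) x * (x - b) ^ i)" for i
    by (rule integrable_normal_moment) simp
  moreover have "normal_density b (1 / sqrt 2) x = exp (- b\<^sup>2) / sqrt pi * exp (- x\<^sup>2 + 2 * b * x)" for x
  proof -
    have "- (x - b)\<^sup>2 = - b\<^sup>2 + (- x\<^sup>2 + 2 * b * x)"
      by (simp add: power2_eq_square algebra_simps)
    thus ?thesis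
      by (simp add: normal_density_def power_divide exp_add[symmetric])
  qed
  ultimately have "integrable lborel (\<lambda>x. (exp (- b\<^sup>2) / sqrt pi) * (exp (- x\<^sup>2 + 2 * b * x) * (x - b) ^ i))" for i
    by (simp add: mult.assoc)
  hence int: "integrable lborel (\<lambda>x. exp (- x\<^sup>2 + 2 * b * x) * (x - b) ^ i)" for i
    by (subst (asm) integrable_mult_left_iff) simp
  have "exp (- x\<^sup>2 + 2 * b * x) * x ^ k =
      (\<Sum>i\<le>k. (of_nat (k choose i) * b ^ (k - i)) * (exp (- x\<^sup>2 + 2 * b * x) * (x - b) ^ i))" for x
    using binomial_ring[of "x - b" b k] by (simp add: sum_distrib_left mult_ac)
  moreover have "integrable lborel (\<lambda>x. \<Sum>i\<le>k. (of_nat (k choose i) * b ^ (k - i)) * (exp (- x\<^sup>2 + 2 * b * x) * (x - b) ^ i))"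
    by (intro Bochner_Integration.integrable_sum integrable_mult_right int)
  ultimately show ?thesis by simp
qed

lemma laguerre_limit_top: "((\<lambda>x::real. exp (- x) * x powr \<alpha> * x ^ k) \<longlongrightarrow> 0) at_top"
proof -
  have "((\<lambda>x::real. exp (- x) * x powr (\<alpha> + k)) \<longlongrightarrow> 0) at_top"
    by real_asymp
  moreover have "eventually (\<lambda>x::real. exp (- x) * x powr (\<alpha> + k) = exp (- x) * x powr \<alpha> * x ^ k) at_top"
    using eventually_gt_at_top[of 0] by eventually_elim (simp add: powr_realpow powr_add)
  ultimately show ?thesis
    by (rule Lim_transform_eventually)
qed

lemma laguerre_limit_0:
  assumes "\<alpha> > 0"
  shows "((\<lambda>x::real. exp (- x) * x powr \<alpha> * x ^ k) \<longlongrightarrow> 0) (at_right 0)"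
proof -
  have "((\<lambda>x::real. exp (- x) * x powr \<alpha> * x ^ k) \<longlongrightarrow> exp (- 0) * 0 * 0 ^ k) (at_right 0)"
  proof (intro tendsto_intros)
    show "((\<lambda>x::real. x powr \<alpha>) \<longlongrightarrow> 0) (at_right 0)"
      using assms by real_asymp
  qed
  thus ?thesis by simp
qed

lemma laguerre_integrable:
  assumes "\<alpha> > -1"
  shows "set_integrable lborel {0<..} (\<lambda>x::real. exp (- x) * x powr \<alpha> * x ^ k)"
proof -
  have meas: "set_borel_measurable lborel {0<..} (\<lambda>x::real. exp (- x) * x powr \<alpha> * x ^ k)"
    unfolding set_borel_measurable_def by measurable
  have "(\<lambda>x. complex_of_real x powr (of_real (\<alpha> + k + 1) - 1) / of_real (exp x))
      absolutely_integrable_on {0<..}"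
    using assms by (intro absolutely_integrable_Gamma_integral') simp
  hence "(\<lambda>x. norm (complex_of_real x powr (of_real (\<alpha> + k + 1) - 1) / of_real (exp x)))
      absolutely_integrable_on {0<..}"
    by (rule set_integrable_norm)
  also have "?this \<longleftrightarrow> (\<lambda>x::real. exp (- x) * x powr \<alpha> * x ^ k) absolutely_integrable_on {0<..}"
  proof (rule set_integrable_cong)
    fix x :: real assume "x \<in> {0<..}"
    thus "norm (complex_of_real x powr (of_real (\<alpha> + k + 1) - 1) / of_real (exp x)) =
        exp (- x) * x powr \<alpha> * x ^ k"
      by (simp add: norm_divide norm_mult norm_power norm_powr_real_powr powr_add powr_realpow exp_minus divide_simps)
  qed auto
  finally show ?thesis
    using meas unfolding set_integrable_def set_borel_measurable_def
    by (simp add: integrable_completion)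
qed

text \<open>
  The substitution \<open>x = 2 t - 1\<close> reduces to the Beta integral; the factor \<open>x\<^sup>k\<close> is bounded by one.
\<close>

lemma jacobi_integrable:
  assumes "\<alpha> > -1" "\<beta> > -1"
  shows "set_integrable lborel {-1<..<1} (\<lambda>x::real. (1 - x) powr \<alpha> * (1 + x) powr \<beta> * x ^ k)"
proof -
  have "set_integrable lborel {0..1} (\<lambda>t. t powr (\<beta> + 1 - 1) * (1 - t) powr (\<alpha> + 1 - 1))"
    using assms by (intro integrable_Beta) auto
  hence "integrable lborel (\<lambda>t. indicator {0..1} t * (t powr \<beta> * (1 - t) powr \<alpha>))"
    by (simp add: set_integrable_def)
  hence "integrable lborel (\<lambda>x. indicator {0..1} (1 / 2 + (1 / 2) * x) *
      ((1 / 2 + (1 / 2) * x) powr \<beta> * (1 - (1 / 2 + (1 / 2) * x)) powr \<alpha>))"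
    by (rule lborel_integrable_real_affine) simp
  hence "set_integrable lborel {-1..1}
      (\<lambda>x. (1 / 2 + (1 / 2) * x) powr \<beta> * (1 - (1 / 2 + (1 / 2) * x)) powr \<alpha>)"
    unfolding set_integrable_def
    by (rule Bochner_Integration.integrable_cong[THEN iffD1, rotated -1]) (auto simp: indicator_def)
  hence *: "set_integrable lborel {-1<..<1}
      (\<lambda>x. (1 / 2 + (1 / 2) * x) powr \<beta> * (1 - (1 / 2 + (1 / 2) * x)) powr \<alpha>)"
    by (rule set_integrable_subset) auto
  have "set_integrable lborel {-1<..<1}
      (\<lambda>x. 2 powr (\<alpha> + \<beta>) * ((1 / 2 + (1 / 2) * x) powr \<beta> * (1 - (1 / 2 + (1 / 2) * x)) powr \<alpha>))"
    using * by (rule set_integrable_mult_right)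
  thus ?thesis
  proof (rule set_integrable_bound)
    show "set_borel_measurable lborel {-1<..<1} (\<lambda>x. (1 - x) powr \<alpha> * (1 + x) powr \<beta> * x ^ k)"
      unfolding set_borel_measurable_def by measurable
    have "norm ((1 - x) powr \<alpha> * (1 + x) powr \<beta> * x ^ k) \<le>
        norm (2 powr (\<alpha> + \<beta>) * ((1 / 2 + (1 / 2) * x) powr \<beta> * (1 - (1 / 2 + (1 / 2) * x)) powr \<alpha>))"
      if "x \<in> {-1<..<1}" for x :: real
    proof -
      have "1 / 2 + (1 / 2) * x = (1 + x) / 2" "1 - (1 / 2 + (1 / 2) * x) = (1 - x) / 2"
        by (simp_all add: field_simps)
      hence "2 powr (\<alpha> + \<beta>) * ((1 / 2 + (1 / 2) * x) powr \<beta> * (1 - (1 / 2 + (1 / 2) * x)) powr \<alpha>) =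
          (1 - x) powr \<alpha> * (1 + x) powr \<beta>"
        using that by (simp only:) (simp add: powr_divide powr_add)
      moreover have "\<bar>x\<bar> ^ k \<le> 1"
        using that by (intro power_le_one) auto
      ultimately show ?thesis
        by (simp add: abs_mult power_abs mult_left_le)
    qed
    thus "AE x in lborel. x \<in> {-1<..<1} \<longrightarrow> norm ((1 - x) powr \<alpha> * (1 + x) powr \<beta> * x ^ k) \<le>
        norm (2 powr (\<alpha> + \<beta>) * ((1 / 2 + (1 / 2) * x) powr \<beta> * (1 - (1 / 2 + (1 / 2) * x)) powr \<alpha>))"
      by auto
  qed
qed

lemma jacobi_limit_left:
  assumes "\<alpha> > 0"
  shows "((\<lambda>x::real. (1 - x) powr \<alpha> * (1 + x) powr \<beta> * x ^ k) \<longlongrightarrow> 0) (at_left 1)"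
proof -
  have "((\<lambda>x::real. (1 - x) powr \<alpha> * (1 + x) powr \<beta> * x ^ k) \<longlongrightarrow> 0 * (1 + 1) powr \<beta> * 1 ^ k) (at_left 1)"
  proof (intro tendsto_intros)
    show "((\<lambda>x::real. (1 - x) powr \<alpha>) \<longlongrightarrow> 0) (at_left 1)"
      using assms by real_asymp
  qed auto
  thus ?thesis by simp
qed

lemma jacobi_limit_right:
  assumes "\<beta> > 0"
  shows "((\<lambda>x::real. (1 - x) powr \<alpha> * (1 + x) powr \<beta> * x ^ k) \<longlongrightarrow> 0) (at_right (-1))"
proof -
  have "((\<lambda>x::real. (1 - x) powr \<alpha> * (1 + x) powr \<beta> * x ^ k) \<longlongrightarrow> (1 - (-1)) powr \<alpha> * 0 * (-1) ^ k) (at_right (-1))"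
  proof (intro tendsto_intros)
    show "((\<lambda>x::real. (1 + x) powr \<beta>) \<longlongrightarrow> 0) (at_right (-1))"
      using assms by real_asymp
  qed auto
  thus ?thesis by simp
qed

section \<open>The classical weights\<close>

lemma admissible_hermite: "admissible 1 [:c, -2:]"
proof -
  have "eigenvalue 1 [:c, -2:] = (\<lambda>n. -2 * of_nat n)"
    by (simp add: eigenvalue_def fun_eq_iff)
  thus ?thesis by (auto simp: admissible_def inj_def)
qed

lemma admissible_laguerre: "admissible [:0, 1:] [:c, -1:]"
proof -
  have "eigenvalue [:0, 1:] [:c, -1:] = (\<lambda>n. - of_nat n)"
    by (simp add: eigenvalue_def fun_eq_iff numeral_2_eq_2)
  thus ?thesis by (auto simp: admissible_def inj_def)
qed

lemma admissible_jacobi: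
  assumes "s > (-2 :: real)"
  shows "admissible [:1, 0, -1:] [:c, - complex_of_real (s + 2):]"
proof -
  have ev: "eigenvalue [:1, 0, -1:] [:c, - complex_of_real (s + 2):] n = - of_real (real n * (real n + s + 1))" for n
    by (cases n) (simp_all add: eigenvalue_def numeral_2_eq_2 algebra_simps)
  have "inj (eigenvalue [:1, 0, -1:] [:c, - complex_of_real (s + 2):])"
  proof (rule injI, rule ccontr)
    fix m n :: nat
    assume eq: "eigenvalue [:1, 0, -1:] [:c, - complex_of_real (s + 2):] m =
      eigenvalue [:1, 0, -1:] [:c, - complex_of_real (s + 2):] n" and ne: "m \<noteq> n"
    from eq have "real m * (real m + s + 1) = real n * (real n + s + 1)"
      unfolding ev neg_equal_iff_equal of_real_eq_iff .
    hence "(real m - real n) * (real m + real n + s + 1) = 0"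
      by (simp add: algebra_simps)
    hence "real m + real n + s + 1 = 0"
      using ne by simp
    moreover have "real m + real n \<ge> 1"
      using ne by linarith
    ultimately show False using assms by linarith
  qed
  thus ?thesis by (simp add: admissible_def)
qed

lemma eigen_family_hermite:
  "eigen_family 1 [:complex_of_real (2 * b), -2:] (monic_op (hermite_weight b))"
proof -
  interpret pearson_weight "hermite_weight b" "-\<infinity>" \<infinity> "\<lambda>x. exp (- x\<^sup>2 + 2 * b * x)" 1 "[:2 * b, -2:]"
  proof
    fix x k
    show "((\<lambda>x. exp (- x\<^sup>2 + 2 * b * x) * poly 1 x) has_real_derivative
        exp (- x\<^sup>2 + 2 * b * x) * poly [:2 * b, - 2:] x) (at x)"
      by (auto intro!: derivative_eq_intros simp: algebra_simps)
    show "set_integrable lborel (einterval (- \<infinity>) \<infinity>) (\<lambda>x. exp (- x\<^sup>2 + 2 * b * x) * x ^ k)"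
      using normal_integrable[of b k] by (simp add: set_integrable_def)
    show "(((\<lambda>x. exp (- x\<^sup>2 + 2 * b * x) * poly 1 x * x ^ k) \<circ> real_of_ereal) \<longlongrightarrow> 0) (at_right (- \<infinity>))"
      using normal_limit_bot[of b k] by (simp add: ereal_tendsto_simps1)
    show "(((\<lambda>x. exp (- x\<^sup>2 + 2 * b * x) * poly 1 x * x ^ k) \<circ> real_of_ereal) \<longlongrightarrow> 0) (at_left \<infinity>)"
      using normal_limit_top[of b k] by (simp add: ereal_tendsto_simps1)
    show "admissible (cpoly 1) (cpoly [:2 * b, - 2:])"
      using admissible_hermite by (simp add: map_poly_pCons)
  qed (auto simp: hermite_weight_def intro!: continuous_intros)
  show ?thesis using eigen_family_monic_op by (simp add: map_poly_pCons)
qed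

lemma eigen_family_laguerre:
  assumes "\<alpha> > -1"
  shows "eigen_family [:0, 1:] [:complex_of_real (\<alpha> + 1), -1:] (monic_op (laguerre_weight \<alpha>))"
proof -
  have I: "einterval 0 \<infinity> = {0<..}"
    by (simp add: zero_ereal_def)
  \<comment> \<open>Multiplication by \<open>A\<close> raises the exponent to a positive one, which gives the boundary values.\<close>
  have lim: "exp (- x) * x powr \<alpha> * poly [:0, 1:] x * x ^ k = exp (- x) * x powr (\<alpha> + 1) * x ^ k"
    if "x > 0" for x :: real and k
    using that by (simp add: powr_add)
  interpret pearson_weight "laguerre_weight \<alpha>" 0 \<infinity> "\<lambda>x. exp (- x) * x powr \<alpha>" "[:0, 1:]" "[:\<alpha> + 1, -1:]"
  proof
    fix x :: real assume "x \<in> einterval 0 \<infinity>"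
    hence x: "x > 0" by (simp add: I)
    have "((\<lambda>x. exp (- x) * x powr \<alpha> * x) has_real_derivative
        exp (- x) * (\<alpha> * x powr (\<alpha> - 1)) * x - exp (- x) * x powr \<alpha> * x + exp (- x) * x powr \<alpha>) (at x)"
      using x by (auto intro!: derivative_eq_intros simp: algebra_simps)
    moreover have "x powr (\<alpha> - 1) * x = x powr \<alpha>"
      using x by (simp add: powr_diff)
    hence "exp (- x) * (\<alpha> * x powr (\<alpha> - 1)) * x - exp (- x) * x powr \<alpha> * x + exp (- x) * x powr \<alpha> =
        exp (- x) * x powr \<alpha> * poly [:\<alpha> + 1, - 1:] x"
      by (simp add: algebra_simps) 
    ultimately show "((\<lambda>x. exp (- x) * x powr \<alpha> * poly [:0, 1:] x) has_real_derivative
        exp (- x) * x powr \<alpha> * poly [:\<alpha> + 1, - 1:] x) (at x)"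
      by simp
  next
    fix k
    show "set_integrable lborel (einterval 0 \<infinity>) (\<lambda>x. exp (- x) * x powr \<alpha> * x ^ k)"
      unfolding I by (rule laguerre_integrable[OF assms])
    have "((\<lambda>x. exp (- x) * x powr \<alpha> * poly [:0, 1:] x * x ^ k) \<longlongrightarrow> 0) (at_right 0)"
    proof (rule Lim_transform_eventually[OF laguerre_limit_0[of "\<alpha> + 1" k]])
      show "\<forall>\<^sub>F x in at_right 0. exp (- x) * x powr (\<alpha> + 1) * x ^ k = exp (- x) * x powr \<alpha> * poly [:0, 1:] x * x ^ k"
        using eventually_at_right_less[of 0] by eventually_elim (simp only: lim)
    qed (use assms in simp)
    thus "(((\<lambda>x. exp (- x) * x powr \<alpha> * poly [:0, 1:] x * x ^ k) \<circ> real_of_ereal) \<longlongrightarrow> 0) (at_right 0)"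
      unfolding zero_ereal_def by (simp only: ereal_tendsto_simps1)
    have "((\<lambda>x. exp (- x) * x powr \<alpha> * poly [:0, 1:] x * x ^ k) \<longlongrightarrow> 0) at_top"
    proof (rule Lim_transform_eventually[OF laguerre_limit_top[of "\<alpha> + 1" k]])
      show "\<forall>\<^sub>F x in at_top. exp (- x) * x powr (\<alpha> + 1) * x ^ k = exp (- x) * x powr \<alpha> * poly [:0, 1:] x * x ^ k"
        using eventually_gt_at_top[of 0] by eventually_elim (simp only: lim)
    qed
    thus "(((\<lambda>x. exp (- x) * x powr \<alpha> * poly [:0, 1:] x * x ^ k) \<circ> real_of_ereal) \<longlongrightarrow> 0) (at_left \<infinity>)"
      by (simp only: ereal_tendsto_simps1)
    show "admissible (cpoly [:0, 1:]) (cpoly [:\<alpha> + 1, - 1:])"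
      using admissible_laguerre by (simp add: map_poly_pCons)
  qed (auto simp: laguerre_weight_def I intro!: continuous_intros)
  show ?thesis using eigen_family_monic_op by (simp add: map_poly_pCons)
qed

lemma eigen_family_jacobi:
  assumes "\<alpha> > -1" "\<beta> > -1"
  shows "eigen_family [:1, 0, -1:] [:complex_of_real (\<beta> - \<alpha>), - complex_of_real (\<alpha> + \<beta> + 2):]
    (monic_op (jacobi_weight \<alpha> \<beta>))"
proof -
  have I: "einterval (-1) 1 = {-1<..<1}"
    using einterval_eq_Icc[of "-1" 1] by (simp add: one_ereal_def)
  let ?\<omega> = "\<lambda>x. (1 - x) powr \<alpha> * (1 + x) powr \<beta>" and ?A = "[:1, 0, -1:] :: real poly"
  have lim: "?\<omega> x * poly ?A x * x ^ k = (1 - x) powr (\<alpha> + 1) * (1 + x) powr (\<beta> + 1) * x ^ k"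
    if "x \<in> {-1<..<1}" for x :: real and k
  proof -
    have "poly ?A x = (1 - x) * (1 + x)" by (simp add: algebra_simps)
    thus ?thesis using that by (simp add: powr_add)
  qed
  interpret pearson_weight "jacobi_weight \<alpha> \<beta>" "-1" 1 ?\<omega> ?A "[:\<beta> - \<alpha>, - (\<alpha> + \<beta> + 2):]"
  proof
    show "(- 1 :: ereal) < 1" by (simp add: one_ereal_def)
  next
    fix x :: real assume "x \<in> einterval (-1) 1"
    hence x: "-1 < x" "x < 1" by (simp_all add: I)
    have "((\<lambda>x. ?\<omega> x * poly ?A x) has_real_derivative
        (- (\<alpha> * (1 - x) powr (\<alpha> - 1)) * (1 + x) powr \<beta> + (1 - x) powr \<alpha> * (\<beta> * (1 + x) powr (\<beta> - 1))) * poly ?A x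
        + ?\<omega> x * (- 2 * x)) (at x)"
      using x by (auto intro!: derivative_eq_intros poly_DERIV simp: algebra_simps)
    also have "(- (\<alpha> * (1 - x) powr (\<alpha> - 1)) * (1 + x) powr \<beta> + (1 - x) powr \<alpha> * (\<beta> * (1 + x) powr (\<beta> - 1))) * poly ?A x
        + ?\<omega> x * (- 2 * x) =
        - \<alpha> * ((1 - x) powr (\<alpha> - 1) * (1 - x)) * (1 + x) powr \<beta> * (1 + x)
        + \<beta> * (1 - x) powr \<alpha> * ((1 + x) powr (\<beta> - 1) * (1 + x)) * (1 - x) + ?\<omega> x * (- 2 * x)"
      by (simp add: algebra_simps)
    also have "(1 - x) powr (\<alpha> - 1) * (1 - x) = (1 - x) powr \<alpha>"
      using x by (simp add: powr_diff)
    also have "(1 + x) powr (\<beta> - 1) * (1 + x) = (1 + x) powr \<beta>"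
      using x by (simp add: powr_diff)
    also have "- \<alpha> * (1 - x) powr \<alpha> * (1 + x) powr \<beta> * (1 + x) + \<beta> * (1 - x) powr \<alpha> * (1 + x) powr \<beta> * (1 - x)
        + ?\<omega> x * (- 2 * x) = ?\<omega> x * poly [:\<beta> - \<alpha>, - (\<alpha> + \<beta> + 2):] x"
      by (simp add: algebra_simps)
    finally show "((\<lambda>x. ?\<omega> x * poly ?A x) has_real_derivative ?\<omega> x * poly [:\<beta> - \<alpha>, - (\<alpha> + \<beta> + 2):] x) (at x)" .
  next
    fix k
    show "set_integrable lborel (einterval (-1) 1) (\<lambda>x. ?\<omega> x * x ^ k)"
      unfolding I by (rule jacobi_integrable[OF assms])
    have "((\<lambda>x. ?\<omega> x * poly ?A x * x ^ k) \<longlongrightarrow> 0) (at_right (-1))"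
    proof (rule Lim_transform_eventually[OF jacobi_limit_right[of "\<beta> + 1" "\<alpha> + 1" k]])
      have "eventually (\<lambda>x. x \<in> {-1<..<1::real}) (at_right (-1))"
        by (rule eventually_at_right_real) simp
      thus "\<forall>\<^sub>F x in at_right (-1). (1 - x) powr (\<alpha> + 1) * (1 + x) powr (\<beta> + 1) * x ^ k = ?\<omega> x * poly ?A x * x ^ k"
        by eventually_elim (simp only: lim)
    qed (use assms in simp)
    thus "(((\<lambda>x. ?\<omega> x * poly ?A x * x ^ k) \<circ> real_of_ereal) \<longlongrightarrow> 0) (at_right (-1))"
      by (simp only: one_ereal_def uminus_ereal.simps ereal_tendsto_simps1)
    have "((\<lambda>x. ?\<omega> x * poly ?A x * x ^ k) \<longlongrightarrow> 0) (at_left 1)"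
    proof (rule Lim_transform_eventually[OF jacobi_limit_left[of "\<alpha> + 1" "\<beta> + 1" k]])
      have "eventually (\<lambda>x. x \<in> {-1<..<1::real}) (at_left 1)"
        by (rule eventually_at_left_real) simp
      thus "\<forall>\<^sub>F x in at_left 1. (1 - x) powr (\<alpha> + 1) * (1 + x) powr (\<beta> + 1) * x ^ k = ?\<omega> x * poly ?A x * x ^ k"
        by eventually_elim (simp only: lim)
    qed (use assms in simp)
    thus "(((\<lambda>x. ?\<omega> x * poly ?A x * x ^ k) \<circ> real_of_ereal) \<longlongrightarrow> 0) (at_left 1)"
      by (simp only: one_ereal_def ereal_tendsto_simps1)
    show "admissible (cpoly ?A) (cpoly [:\<beta> - \<alpha>, - (\<alpha> + \<beta> + 2):])"
      using admissible_jacobi[of "\<alpha> + \<beta>" "of_real (\<beta> - \<alpha>)"] assms by (simp add: map_poly_pCons add.assoc)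
  qed (auto simp: jacobi_weight_def I intro!: continuous_intros)
  show ?thesis using eigen_family_monic_op by (simp add: map_poly_pCons)
qed

section \<open>The intertwining operators\<close>

text \<open>
  Both sides have order at most three. The coefficients of the third derivative agree automatically; the
  assumptions compare those of \<open>p''\<close> and \<open>p'\<close>.
\<close>

lemma first_order_intertwines:
  assumes "pderiv (pderiv h) = 0"
    and "h * (pderiv A + B1 - B2) = 2 * pderiv h * A"
    and "h * pderiv B1 + smult c B1 = (pderiv h + [:c:]) * B2"
  shows "second_order A B1 * first_order h c = first_order h c * second_order A B2"
proof (rule diff_op_eqI)
  fix p :: "complex poly"
  let ?p1 = "pderiv p" let ?p2 = "pderiv ?p1" let ?p3 = "pderiv ?p2"
  have "p \<cdot> (second_order A B1 * first_order h c) - p \<cdot> (first_order h c * second_order A B2) =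
      ?p2 * (h * (pderiv A + B1 - B2) - 2 * pderiv h * A) +
      ?p1 * (h * pderiv B1 + smult c B1 - (pderiv h + [:c:]) * B2)"
    by (simp add: act_times act_second_order act_first_order pderiv_add pderiv_mult pderiv_smult
        assms(1) algebra_simps smult_add_right)
  thus "p \<cdot> (second_order A B1 * first_order h c) = p \<cdot> (first_order h c * second_order A B2)"
    unfolding assms(2,3) by simp
qed

text \<open>
  The operators \<open>N k, \<dots>, N 1\<close> lower the parameter one step at a time.
\<close>

lemma prod_list_intertwines:
  fixes D N :: "nat \<Rightarrow> diff_op"
  assumes "\<And>j. D (Suc j) * N (Suc j) = N (Suc j) * D j"
  shows "D k * prod_list (map N (rev [1..<k + 1])) = prod_list (map N (rev [1..<k + 1])) * D 0"
proof (induction k)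
  case (Suc k)
  let ?P = "prod_list (map N (rev [1..<k + 1]))"
  have "D (Suc k) * (N (Suc k) * ?P) = N (Suc k) * (D k * ?P)"
    by (simp only: assms mult.assoc[symmetric])
  also have "\<dots> = (N (Suc k) * ?P) * D 0"
    by (simp only: Suc mult.assoc)
  finally show ?case by simp
qed simp

text \<open>
  On the coefficient of \<open>x\<^sup>n\<close> the operator acts as multiplication by \<open>n h\<^sub>1 + c\<close>, up to contributions of higher
  coefficients.
\<close>

lemma degree_preserving_first_order:
  assumes "degree h \<le> 1" "\<And>n. of_nat n * coeff h 1 + c \<noteq> 0"
  shows "degree_preserving (first_order h c)"
  unfolding degree_preserving_def
proof (intro allI impI)
  fix p :: "complex poly" assume "p \<noteq> 0"
  have h: "h = [:coeff h 0, coeff h 1:]"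
    using assms(1) by (intro poly_eqI) (auto simp: coeff_pCons coeff_eq_0 split: nat.splits)
  have coeff: "coeff (p \<cdot> first_order h c) n =
      of_nat (n + 1) * coeff h 0 * coeff p (n + 1) + (of_nat n * coeff h 1 + c) * coeff p n" for n
    unfolding act_first_order
    by (subst h) (cases n, auto simp: coeff_pderiv algebra_simps)
  have "coeff (p \<cdot> first_order h c) (degree p) \<noteq> 0"
    using assms(2) \<open>p \<noteq> 0\<close> by (simp only: coeff) (simp add: coeff_eq_0)
  moreover have "degree (p \<cdot> first_order h c) \<le> degree p"
    by (intro degree_le allI impI) (simp only: coeff, simp add: coeff_eq_0)
  ultimately show "p \<cdot> first_order h c \<noteq> 0 \<and> degree (p \<cdot> first_order h c) = degree p"
    by (metis antisym coeff_0 le_degree)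
qed

lemma degree_preserving_prod_list:
  "(\<And>D. D \<in> set Ds \<Longrightarrow> degree_preserving D) \<Longrightarrow> degree_preserving (prod_list Ds)"
  by (induction Ds) (auto simp: degree_preserving_def act_times act_one)

lemma partial_minus_one: "\<partial> - 1 = first_order 1 (-1)"
  by (rule diff_op_eqI) (simp add: act_first_order act_diff act_partial act_one)

lemma partial_minus_one_power:
  "(\<partial> - 1) ^ k = prod_list (map (\<lambda>j. first_order 1 (-1)) (rev [1..<k + 1]))"
  by (simp add: partial_minus_one map_replicate_const del: upt_Suc)

section \<open>Isospectral weights\<close>

lemma op_space_iff_intertwiner:
  assumes "admissible A2 B2" "eigen_family A1 B1 (monic_op w1)" "eigen_family A2 B2 (monic_op w2)"
    and "eigenvalue A1 B1 = eigenvalue A2 B2"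
  shows "T \<in> \<D>(w1, w2) \<longleftrightarrow> second_order A1 B1 * T = T * second_order A2 B2"
  using intertwiner_iff[OF assms] by (simp add: op_space_def)

lemma zero_in_op_space: "0 \<in> \<D>(w1, w2)"
  unfolding op_space_def by (auto simp: act_zero intro!: exI[of _ "\<lambda>_. 0"])

lemma op_space_cyclic_zero:
  assumes "\<And>T. T \<in> \<D>(w1, w2) \<Longrightarrow> T = 0"
  shows "\<D>(w1, w2) = (\<lambda>S. 0 * S) ` \<D>(w2)"
  using assms zero_in_op_space by fastforce

text \<open>
  Degree-preserving operators in both directions give a factorisation of the element \<open>V N\<close> of the algebra
  of \<open>w2\<close>.
\<close>

lemma darboux_transformationI:
  assumes "interval w1 = interval w2" "V \<in> \<D>(w2, w1)" "N \<in> \<D>(w1, w2)"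
    "degree_preserving V" "degree_preserving N"
  shows "darboux_transformation_of w1 w2"
  unfolding darboux_transformation_of_def
  using assms op_space_times[OF assms(2,3)] unfolding op_space_def by blast

lemma darboux_transformation_refl: "darboux_transformation_of w w"
  by (rule darboux_transformationI[of _ _ 1 1]) (auto simp: op_alg_one degree_preserving_def act_one)

text \<open>
  The shared coefficient \<open>A\<close> and the shared eigenvalues turn the spaces of operators between the two weights
  into spaces of intertwiners, to which the induction on the order applies.
\<close>

locale isospectral_weights =
  fixes w1 w2 :: weight and A B1 B2 :: "complex poly"
  assumes admissible: "admissible A B1" "admissible A B2"
    and families: "eigen_family A B1 (monic_op w1)" "eigen_family A B2 (monic_op w2)"
    and spectrum: "coeff B1 1 = coeff B2 1"
    and intervals: "interval w1 = interval w2"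
begin

lemma op_space_iff:
  "T \<in> \<D>(w1, w2) \<longleftrightarrow> second_order A B1 * T = T * second_order A B2"
  "T \<in> \<D>(w2, w1) \<longleftrightarrow> second_order A B2 * T = T * second_order A B1"
  "T \<in> \<D>(w2) \<longleftrightarrow> second_order A B2 * T = T * second_order A B2"
proof -
  have ev: "eigenvalue A B1 = eigenvalue A B2"
    by (intro ext) (simp only: eigenvalue_def spectrum)
  show "T \<in> \<D>(w1, w2) \<longleftrightarrow> second_order A B1 * T = T * second_order A B2"
    by (rule op_space_iff_intertwiner[OF admissible(2) families ev])
  show "T \<in> \<D>(w2, w1) \<longleftrightarrow> second_order A B2 * T = T * second_order A B1"
    by (rule op_space_iff_intertwiner[OF admissible(1) families(2,1) ev[symmetric]])
  show "T \<in> \<D>(w2) \<longleftrightarrow> second_order A B2 * T = T * second_order A B2"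
    by (rule op_space_iff_intertwiner[OF admissible(2) families(2,2) refl])
qed

lemma leading_equation:
  assumes "T \<in> \<D>(w1, w2)" "leading T m f"
  shows "2 * A * pderiv f = (B1 - B2 + of_nat m * pderiv A) * f"
  using intertwiner_leading_equation assms op_space_iff by blast

lemma cyclic:
  assumes T0: "T0 \<in> \<D>(w1, w2)" "leading T0 k g"
    and symbols: "\<And>T m f. T \<in> \<D>(w1, w2) \<Longrightarrow> leading T m f \<Longrightarrow> f \<noteq> 0 \<Longrightarrow>
       \<exists>r c. m = k + 2 * r \<and> f = smult c (g * A ^ r)"
  shows "\<D>(w1, w2) = (\<lambda>S. T0 * S) ` \<D>(w2)"
proof (intro equalityI subsetI)
  fix T assume "T \<in> \<D>(w1, w2)"
  then obtain S where "T = T0 * S" "second_order A B2 * S = S * second_order A B2"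
    using intertwiner_cyclic[of "second_order A B1" T0 "second_order A B2" k g A B2 T] T0 symbols
    by (auto simp: op_space_iff)
  thus "T \<in> (\<lambda>S. T0 * S) ` \<D>(w2)"
    by (auto simp: op_space_iff)
qed (use T0 in \<open>auto intro: op_space_times\<close>)

lemma degree_coefficient:
  assumes "T \<in> \<D>(w1, w2)"
  shows "degree (coeff_op T j) \<le> j"
proof (rule degree_coeff_op_le)
  fix n
  have "degree (monic_op w1 i \<cdot> T) \<le> i" for i
    using assms eigen_familyD(1)[OF families(2)] unfolding op_space_def
    by (auto intro: order.trans[OF degree_smult_le])
  hence "degree (monom 1 n \<cdot> T) \<le> degree (monom 1 n :: complex poly)"
    by (intro degree_act_le[of "monic_op w1"] eigen_familyD[OF families(1)])
  thus "degree (monom 1 n \<cdot> T) \<le> n"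
    by (simp add: degree_monom_eq)
qed

end

section \<open>Hermite and Laguerre weights\<close>

lemma interval_simps:
  "interval (hermite_weight b) = UNIV"
  "interval (laguerre_weight \<alpha>) = {0<..}"
  "interval (jacobi_weight \<alpha> \<beta>) = {-1<..<1}"
  by (simp_all add: hermite_weight_def laguerre_weight_def jacobi_weight_def)

lemma hermite_op_space_zero:
  assumes "b1 \<noteq> b2" "T \<in> \<D>(hermite_weight b1, hermite_weight b2)"
  shows "T = 0"
proof (rule ccontr)
  interpret isospectral_weights "hermite_weight b1" "hermite_weight b2" 1
    "[:complex_of_real (2 * b1), -2:]" "[:complex_of_real (2 * b2), -2:]"
    by unfold_locales (rule admissible_hermite eigen_family_hermite | simp add: interval_simps)+
  assume "T \<noteq> 0"
  then obtain m f where f: "leading T m f" "f \<noteq> 0"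
    using leading_exists by blast
  have "2 * pderiv f = [:complex_of_real (2 * (b1 - b2)):] * f"
    using leading_equation[OF assms(2) f(1)] by (simp add: algebra_simps)
  from hermite_symbol[OF this] f(2) assms(1) show False by simp
qed

context
  fixes \<alpha>1 \<alpha>2 :: real
  assumes \<alpha>: "\<alpha>1 > -1" "\<alpha>2 > -1"
begin

interpretation isospectral_weights "laguerre_weight \<alpha>1" "laguerre_weight \<alpha>2" "[:0, 1:]"
    "[:complex_of_real (\<alpha>1 + 1), -1:]" "[:complex_of_real (\<alpha>2 + 1), -1:]"
  by unfold_locales (rule admissible_laguerre eigen_family_laguerre \<alpha> | simp add: interval_simps)+

text \<open>
  The bound \<open>r \<le> m\<close> comes from the degree filtration. When the parameter drops by \<open>k\<close>,
  the equation \<open>2 r = m + k\<close> alone does not prevent \<open>r < k\<close>.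
\<close>

lemma laguerre_leading:
  assumes T: "T \<in> \<D>(laguerre_weight \<alpha>1, laguerre_weight \<alpha>2)" and f: "leading T m f" "f \<noteq> 0"
  shows "\<exists>r c. \<alpha>1 - \<alpha>2 + real m = 2 * real r \<and> r \<le> m \<and> f = smult c ([:0, 1:] ^ r)"
proof -
  have "2 * [:0, 1:] * pderiv f = [:complex_of_real (\<alpha>1 - \<alpha>2 + real m):] * f"
    using leading_equation[OF T f(1)] by (simp add: pderiv_pCons of_nat_poly algebra_simps)
  from laguerre_symbol[OF this f(2)] obtain r c where
    r: "complex_of_real (\<alpha>1 - \<alpha>2 + real m) = 2 * of_nat r" and c: "f = smult c ([:0, 1:] ^ r)" by blast
  have "complex_of_real (\<alpha>1 - \<alpha>2 + real m) = complex_of_real (2 * real r)"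
    using r by simp
  hence "\<alpha>1 - \<alpha>2 + real m = 2 * real r"
    by (simp only: of_real_eq_iff)
  moreover have "r \<le> m"
  proof -
    have "degree f = r"
      using c f(2) by (cases "c = 0") (auto simp: degree_power_eq)
    thus ?thesis using degree_coefficient[OF T, of m] f(1) by (auto simp: leading_def)
  qed
  ultimately show ?thesis using c by blast
qed

lemma laguerre_up_in_op_space:
  assumes "\<alpha>2 = \<alpha>1 + real k"
  shows "(\<partial> - 1) ^ k \<in> \<D>(laguerre_weight \<alpha>1, laguerre_weight \<alpha>2)"
proof -
  let ?D = "\<lambda>j. second_order [:0, 1:] [:complex_of_real (\<alpha>1 + real k - real j + 1), -1:]"
  have "?D (Suc j) * first_order 1 (-1) = first_order 1 (-1) * ?D j" for j
    by (rule first_order_intertwines) (simp_all add: pderiv_pCons pderiv_1)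
  from prod_list_intertwines[of ?D, OF this, of k] show ?thesis
    unfolding op_space_iff partial_minus_one_power using assms by (simp del: upt_Suc)
qed

lemma laguerre_down_in_op_space:
  assumes "\<alpha>1 = \<alpha>2 + real k"
  shows "prod_list (map (\<lambda>j. first_order [:0, 1:] (complex_of_real (\<alpha>2 + real j))) (rev [1..<k + 1]))
    \<in> \<D>(laguerre_weight \<alpha>1, laguerre_weight \<alpha>2)"
proof -
  let ?D = "\<lambda>j. second_order [:0, 1:] [:complex_of_real (\<alpha>2 + real j + 1), -1:]"
  let ?N = "\<lambda>j. first_order [:0, 1:] (complex_of_real (\<alpha>2 + real j))"
  have "?D (Suc j) * ?N (Suc j) = ?N (Suc j) * ?D j" for j
    by (rule first_order_intertwines) (simp_all add: pderiv_pCons numeral_poly algebra_simps)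
  from prod_list_intertwines[of ?D ?N, OF this, of k] show ?thesis
    unfolding op_space_iff using assms by (simp del: upt_Suc)
qed

lemma laguerre_up_cyclic:
  assumes "\<alpha>2 = \<alpha>1 + real k"
  shows "\<D>(laguerre_weight \<alpha>1, laguerre_weight \<alpha>2) =
    (\<lambda>S. (\<partial> - 1) ^ k * S) ` \<D>(laguerre_weight \<alpha>2)"
proof (rule cyclic[OF laguerre_up_in_op_space[OF assms]])
  show "leading ((\<partial> - 1) ^ k) k 1"
    using leading_prod_first_order[of 1 "\<lambda>_. -1" "rev [1..<k + 1]"]
    unfolding partial_minus_one_power by (simp del: upt_Suc)
next
  fix T m f
  assume "T \<in> \<D>(laguerre_weight \<alpha>1, laguerre_weight \<alpha>2)" "leading T m f" "f \<noteq> 0"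
  from laguerre_leading[OF this] obtain r c where
    "\<alpha>1 - \<alpha>2 + real m = 2 * real r" "f = smult c ([:0, 1:] ^ r)" by blast
  moreover from this(1) have "real m = real (k + 2 * r)"
    using assms by simp
  hence "m = k + 2 * r"
    by (simp only: of_nat_eq_iff)
  ultimately show "\<exists>r c. m = k + 2 * r \<and> f = smult c (1 * [:0, 1:] ^ r)"
    by auto
qed

lemma laguerre_down_cyclic:
  assumes "\<alpha>1 = \<alpha>2 + real k"
  shows "\<D>(laguerre_weight \<alpha>1, laguerre_weight \<alpha>2) =
    (\<lambda>S. prod_list (map (\<lambda>j. first_order [:0, 1:] (complex_of_real (\<alpha>2 + real j))) (rev [1..<k + 1])) * S)
      ` \<D>(laguerre_weight \<alpha>2)"
    (is "_ = (\<lambda>S. ?N * S) ` _")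
proof (rule cyclic[OF laguerre_down_in_op_space[OF assms]])
  show "leading ?N k ([:0, 1:] ^ k)"
    using leading_prod_first_order[of "[:0, 1:]" "\<lambda>j. complex_of_real (\<alpha>2 + real j)" "rev [1..<k + 1]"]
    by (simp del: upt_Suc)
next
  fix T m f
  assume "T \<in> \<D>(laguerre_weight \<alpha>1, laguerre_weight \<alpha>2)" "leading T m f" "f \<noteq> 0"
  from laguerre_leading[OF this] obtain r c where
    r: "\<alpha>1 - \<alpha>2 + real m = 2 * real r" "r \<le> m" and f: "f = smult c ([:0, 1:] ^ r)" by blast
  have "real (m + k) = real (2 * r)"
    using r(1) assms by simp
  hence m: "m + k = 2 * r"
    by (simp only: of_nat_eq_iff)
  \<comment> \<open>The inequality \<open>k \<le> r\<close> follows from \<open>2 r = m + k\<close> and \<open>r \<le> m\<close>.\<close>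
  define q where "q = r - k"
  have q: "r = k + q" "m = k + 2 * q"
    using m r(2) by (auto simp: q_def)
  show "\<exists>r c. m = k + 2 * r \<and> f = smult c ([:0, 1:] ^ k * [:0, 1:] ^ r)"
    using f q by (auto simp: power_add)
qed

lemma laguerre_op_space_zero:
  assumes "\<alpha>1 \<noteq> \<alpha>2" "\<And>k. k \<ge> 1 \<Longrightarrow> \<alpha>2 \<noteq> \<alpha>1 + real k" "\<And>k. k \<ge> 1 \<Longrightarrow> \<alpha>1 \<noteq> \<alpha>2 + real k"
    and T: "T \<in> \<D>(laguerre_weight \<alpha>1, laguerre_weight \<alpha>2)"
  shows "T = 0"
proof (rule ccontr)
  assume "T \<noteq> 0"
  then obtain m f where f: "leading T m f" "f \<noteq> 0"
    using leading_exists by blast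
  from laguerre_leading[OF T f] obtain r where r: "\<alpha>1 - \<alpha>2 + real m = 2 * real r" by blast
  show False
  proof (cases m "2 * r" rule: linorder_cases)
    case less
    hence "\<alpha>1 = \<alpha>2 + real (2 * r - m)" using r by (simp add: of_nat_diff)
    moreover have "2 * r - m \<ge> 1" using less by linarith
    ultimately show False using assms(3) by blast
  next
    case equal
    hence "real m = 2 * real r" by simp
    with r assms(1) show False by simp
  next
    case greater
    hence "\<alpha>2 = \<alpha>1 + real (m - 2 * r)" using r by (simp add: of_nat_diff)
    moreover have "m - 2 * r \<ge> 1" using greater by linarith
    ultimately show False using assms(2) by blast
  qed
qed

end

lemma degree_preserving_laguerre_up: "degree_preserving ((\<partial> - 1) ^ k)"
  unfolding partial_minus_one_power
  by (intro degree_preserving_prod_list) (auto intro!: degree_preserving_first_order)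

lemma degree_preserving_down:
  assumes "\<alpha> > (-1 :: real)"
  shows "degree_preserving (prod_list (map (\<lambda>j. first_order [:c, 1:] (complex_of_real (\<alpha> + real j))) (rev [1..<k + 1])))"
proof (rule degree_preserving_prod_list)
  fix D assume "D \<in> set (map (\<lambda>j. first_order [:c, 1:] (complex_of_real (\<alpha> + real j))) (rev [1..<k + 1]))"
  then obtain j where j: "j \<ge> 1" "D = first_order [:c, 1:] (complex_of_real (\<alpha> + real j))"
    by auto
  have "of_nat n * coeff [:c, 1:] 1 + complex_of_real (\<alpha> + real j) \<noteq> 0" for n
  proof -
    have "real n + (\<alpha> + real j) \<noteq> 0" using assms j(1) by simp
    hence "complex_of_real (real n + (\<alpha> + real j)) \<noteq> 0" unfolding of_real_eq_0_iff .
    thus ?thesis by simp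
  qed
  thus "degree_preserving D"
    unfolding j(2) by (intro degree_preserving_first_order) simp_all
qed

lemma laguerre_shift_darboux:
  assumes "\<alpha> > -1"
  shows "darboux_transformation_of (laguerre_weight \<alpha>) (laguerre_weight (\<alpha> + real k))"
    "darboux_transformation_of (laguerre_weight (\<alpha> + real k)) (laguerre_weight \<alpha>)"
proof -
  have \<alpha>k: "\<alpha> + real k > -1" using assms by simp
  note up = laguerre_up_in_op_space[OF assms \<alpha>k refl] degree_preserving_laguerre_up
  note down = laguerre_down_in_op_space[OF \<alpha>k assms refl] degree_preserving_down[OF assms]
  show "darboux_transformation_of (laguerre_weight \<alpha>) (laguerre_weight (\<alpha> + real k))"
    by (rule darboux_transformationI[OF _ down(1) up(1) down(2) up(2)]) (simp add: interval_simps)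
  show "darboux_transformation_of (laguerre_weight (\<alpha> + real k)) (laguerre_weight \<alpha>)"
    by (rule darboux_transformationI[OF _ up(1) down(1) up(2) down(2)]) (simp add: interval_simps)
qed

lemma laguerre_generator:
  assumes \<alpha>: "\<alpha>1 > -1" "\<alpha>2 > -1"
  defines "w1 \<equiv> laguerre_weight \<alpha>1" and "w2 \<equiv> laguerre_weight \<alpha>2"
  shows "\<exists>T. \<D>(w1, w2) = (\<lambda>S. T * S) ` \<D>(w2) \<and>
    (\<not> darboux_transformation_of w1 w2 \<longrightarrow> T = 0) \<and> (\<alpha>1 = \<alpha>2 \<longrightarrow> T = 1) \<and>
    (\<forall>k\<ge>1. \<alpha>2 = \<alpha>1 + real k \<longrightarrow> T = (\<partial> - 1) ^ k) \<and>
    (\<forall>k\<ge>1. \<alpha>1 = \<alpha>2 + real k \<longrightarrow>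
       T = prod_list (map (\<lambda>j. first_order [:0, 1:] (complex_of_real (\<alpha>2 + real j))) (rev [1..<k + 1])))"
proof -
  consider (same) "\<alpha>1 = \<alpha>2" | (up) k where "k \<ge> 1" "\<alpha>2 = \<alpha>1 + real k"
    | (down) k where "k \<ge> 1" "\<alpha>1 = \<alpha>2 + real k"
    | (none) "\<alpha>1 \<noteq> \<alpha>2" "\<And>k. k \<ge> 1 \<Longrightarrow> \<alpha>2 \<noteq> \<alpha>1 + real k" "\<And>k. k \<ge> 1 \<Longrightarrow> \<alpha>1 \<noteq> \<alpha>2 + real k"
    by blast
  thus ?thesis
  proof cases
    case same
    hence "w1 = w2" by (simp add: w1_def w2_def)
    thus ?thesis using same darboux_transformation_refl[of w2]
      by (intro exI[of _ 1]) (simp del: upt_Suc)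
  next
    case up
    thus ?thesis using laguerre_up_cyclic[OF \<alpha> up(2)] laguerre_shift_darboux(1)[OF \<alpha>(1), of k]
      by (intro exI[of _ "(\<partial> - 1) ^ k"]) (auto simp: w1_def w2_def simp del: upt_Suc)
  next
    case down
    thus ?thesis using laguerre_down_cyclic[OF \<alpha> down(2)] laguerre_shift_darboux(2)[OF \<alpha>(2), of k]
      by (intro exI[of _ "prod_list (map (\<lambda>j. first_order [:0, 1:] (complex_of_real (\<alpha>2 + real j))) (rev [1..<k + 1]))"])
         (auto simp: w1_def w2_def simp del: upt_Suc)
  next
    case none
    have "\<D>(w1, w2) = (\<lambda>S. 0 * S) ` \<D>(w2)"
      unfolding w1_def w2_def by (rule op_space_cyclic_zero) (rule laguerre_op_space_zero[OF \<alpha> none])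
    thus ?thesis using none by (intro exI[of _ 0]) blast
  qed
qed

section \<open>Jacobi weights\<close>

abbreviation jacobi_drift :: "real \<Rightarrow> real \<Rightarrow> complex poly" where
  "jacobi_drift \<alpha> \<beta> \<equiv> [:complex_of_real (\<beta> - \<alpha>), - complex_of_real (\<alpha> + \<beta> + 2):]"

lemma jacobi_op_space_zero_if_sums_differ:
  assumes "\<alpha>1 > -1" "\<beta>1 > -1" "\<alpha>2 > -1" "\<beta>2 > -1" and ne: "\<alpha>1 + \<beta>1 \<noteq> \<alpha>2 + \<beta>2"
    and T: "T \<in> \<D>(jacobi_weight \<alpha>1 \<beta>1, jacobi_weight \<alpha>2 \<beta>2)"
  shows "T = 0"
proof -
  from T obtain \<Lambda> where \<Lambda>:
    "monic_op (jacobi_weight \<alpha>1 \<beta>1) n \<cdot> T = smult (\<Lambda> n) (monic_op (jacobi_weight \<alpha>2 \<beta>2) n)" for n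
    by (auto simp: op_space_def)
  have drift: "poly (jacobi_drift \<alpha> \<beta> + of_nat j * pderiv [:1, 0, -1:]) 1 \<noteq> 0" if "\<alpha> > -1" for \<alpha> \<beta> j
  proof -
    have "\<alpha> + 1 + real j \<noteq> 0" using that by linarith
    hence "complex_of_real (\<alpha> + 1 + real j) \<noteq> 0" unfolding of_real_eq_0_iff .
    moreover have eq: "poly (jacobi_drift \<alpha> \<beta> + of_nat j * pderiv [:1, 0, -1:]) 1 =
        - 2 * complex_of_real (\<alpha> + 1 + real j)"
      by (simp add: pderiv_pCons algebra_simps)
    ultimately show ?thesis
      unfolding eq mult_eq_0_iff by simp
  qed
  have "- complex_of_real (\<alpha>1 + \<beta>1 + 2) \<noteq> - complex_of_real (\<alpha>2 + \<beta>2 + 2)"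
    using ne unfolding neg_equal_iff_equal of_real_eq_iff by simp
  hence "coeff (jacobi_drift \<alpha>1 \<beta>1) 1 \<noteq> coeff (jacobi_drift \<alpha>2 \<beta>2) 1"
    by (simp del: of_real_add)
  thus ?thesis
    using op_space_eq_0_if_spectra_differ[of "[:1, 0, -1:]" "jacobi_drift \<alpha>1 \<beta>1" "jacobi_drift \<alpha>2 \<beta>2" 1,
        OF _ _ _ _ _ drift drift _ eigen_family_jacobi eigen_family_jacobi \<Lambda>] assms
    by (simp add: numeral_2_eq_2)
qed

context
  fixes \<alpha>1 \<beta>1 \<alpha>2 \<beta>2 :: real
  assumes par: "\<alpha>1 > -1" "\<beta>1 > -1" "\<alpha>2 > -1" "\<beta>2 > -1" and sums: "\<alpha>1 + \<beta>1 = \<alpha>2 + \<beta>2"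
begin

interpretation isospectral_weights "jacobi_weight \<alpha>1 \<beta>1" "jacobi_weight \<alpha>2 \<beta>2" "[:1, 0, -1:]"
    "jacobi_drift \<alpha>1 \<beta>1" "jacobi_drift \<alpha>2 \<beta>2"
proof
  show "admissible [:1, 0, -1:] (jacobi_drift \<alpha>1 \<beta>1)" "admissible [:1, 0, -1:] (jacobi_drift \<alpha>2 \<beta>2)"
    by (rule admissible_jacobi, use par in simp)+
  show "coeff (jacobi_drift \<alpha>1 \<beta>1) 1 = coeff (jacobi_drift \<alpha>2 \<beta>2) 1"
    unfolding sums by simp
qed (rule eigen_family_jacobi par | simp add: interval_simps)+

text \<open>
  With equal parameter sums the difference of the drifts is the constant \<open>2 (\<alpha>2 - \<alpha>1)\<close>.
\<close>

lemma jacobi_leading: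
  assumes T: "T \<in> \<D>(jacobi_weight \<alpha>1 \<beta>1, jacobi_weight \<alpha>2 \<beta>2)" and f: "leading T m f" "f \<noteq> 0"
  shows "\<exists>a b c. f = smult c ([:-1, 1:] ^ a * [:1, 1:] ^ b) \<and> m = a + b \<and> \<alpha>2 - \<alpha>1 = real b - real a"
proof -
  have "complex_of_real (\<beta>1 - \<alpha>1 - (\<beta>2 - \<alpha>2)) = complex_of_real (2 * (\<alpha>2 - \<alpha>1))"
  proof (rule arg_cong[where f = complex_of_real])
    show "\<beta>1 - \<alpha>1 - (\<beta>2 - \<alpha>2) = 2 * (\<alpha>2 - \<alpha>1)"
      using sums by algebra
  qed
  moreover have "complex_of_real (\<alpha>1 + \<beta>1) = complex_of_real (\<alpha>2 + \<beta>2)"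
    by (simp only: sums)
  ultimately have drift: "jacobi_drift \<alpha>1 \<beta>1 - jacobi_drift \<alpha>2 \<beta>2 + of_nat m * pderiv [:1, 0, -1:] =
      [:2 * complex_of_real (\<alpha>2 - \<alpha>1), -2 * of_nat m:]"
    by (simp add: pderiv_pCons of_nat_poly)
  from leading_equation[OF T f(1)]
  have "2 * [:1, 0, -1:] * pderiv f = [:2 * complex_of_real (\<alpha>2 - \<alpha>1), -2 * of_nat m:] * f"
    unfolding drift .
  from jacobi_symbol[OF this f(2)] obtain a b c where
    abc: "f = smult c ([:-1, 1:] ^ a * [:1, 1:] ^ b)" "m = a + b" "complex_of_real (\<alpha>2 - \<alpha>1) = of_nat b - of_nat a"
    by blast
  have "complex_of_real (\<alpha>2 - \<alpha>1) = complex_of_real (real b - real a)"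
    using abc(3) by simp
  hence "\<alpha>2 - \<alpha>1 = real b - real a"
    unfolding of_real_eq_iff .
  thus ?thesis using abc by blast
qed

lemma jacobi_right_in_op_space:
  assumes "\<alpha>2 = \<alpha>1 + real k"
  shows "prod_list (map (\<lambda>j. first_order [:1, 1:] (complex_of_real (\<beta>2 + real j))) (rev [1..<k + 1]))
    \<in> \<D>(jacobi_weight \<alpha>1 \<beta>1, jacobi_weight \<alpha>2 \<beta>2)"
proof -
  let ?D = "\<lambda>j. second_order [:1, 0, -1:] (jacobi_drift (\<alpha>2 - real j) (\<beta>2 + real j))"
  let ?N = "\<lambda>j. first_order [:1, 1:] (complex_of_real (\<beta>2 + real j))"
  have step: "?D (Suc j) * ?N (Suc j) = ?N (Suc j) * ?D j" for j
    by (rule first_order_intertwines) (simp_all add: pderiv_pCons numeral_poly algebra_simps)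
  have "\<alpha>2 - real k = \<alpha>1" "\<beta>2 + real k = \<beta>1" "\<alpha>2 - real 0 = \<alpha>2" "\<beta>2 + real 0 = \<beta>2"
    using assms sums by simp_all
  with prod_list_intertwines[of ?D ?N, OF step, of k] show ?thesis
    unfolding op_space_iff by (simp only:)
qed

lemma jacobi_left_in_op_space:
  assumes "\<alpha>1 = \<alpha>2 + real k"
  shows "prod_list (map (\<lambda>j. first_order [:-1, 1:] (complex_of_real (\<alpha>2 + real j))) (rev [1..<k + 1]))
    \<in> \<D>(jacobi_weight \<alpha>1 \<beta>1, jacobi_weight \<alpha>2 \<beta>2)"
proof -
  let ?D = "\<lambda>j. second_order [:1, 0, -1:] (jacobi_drift (\<alpha>2 + real j) (\<beta>2 - real j))"
  let ?N = "\<lambda>j. first_order [:-1, 1:] (complex_of_real (\<alpha>2 + real j))"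
  have step: "?D (Suc j) * ?N (Suc j) = ?N (Suc j) * ?D j" for j
    by (rule first_order_intertwines) (simp_all add: pderiv_pCons numeral_poly algebra_simps)
  have "\<alpha>2 + real k = \<alpha>1" "\<beta>2 - real k = \<beta>1" "\<alpha>2 + real 0 = \<alpha>2" "\<beta>2 - real 0 = \<beta>2"
    using assms sums by simp_all
  with prod_list_intertwines[of ?D ?N, OF step, of k] show ?thesis
    unfolding op_space_iff by (simp only:)
qed

text \<open>
  Converts between the powers of \<open>A = 1 - x\<^sup>2\<close> and the factors \<open>x - 1\<close>, \<open>x + 1\<close> in the solutions of the leading
  coefficient equation.
\<close>

lemma one_minus_square_power_eq:
  "([:1, 0, -1:] :: complex poly) ^ a = smult ((-1) ^ a) ([:-1, 1:] ^ a * [:1, 1:] ^ a)"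
proof -
  have "([:1, 0, -1:] :: complex poly) = smult (-1) ([:-1, 1:] * [:1, 1:])"
    by simp
  thus ?thesis by (simp only: smult_power power_mult_distrib)
qed

text \<open>
  The number of factors \<open>x + 1\<close> exceeds the number of factors \<open>x - 1\<close> by the shift \<open>k\<close>. The excess is the leading
  coefficient of the product operator, the rest is a power of \<open>A\<close>.
\<close>

lemma jacobi_right_cyclic:
  assumes "\<alpha>2 = \<alpha>1 + real k"
  shows "\<D>(jacobi_weight \<alpha>1 \<beta>1, jacobi_weight \<alpha>2 \<beta>2) =
    (\<lambda>S. prod_list (map (\<lambda>j. first_order [:1, 1:] (complex_of_real (\<beta>2 + real j))) (rev [1..<k + 1])) * S)
      ` \<D>(jacobi_weight \<alpha>2 \<beta>2)"
    (is "_ = (\<lambda>S. ?N * S) ` _")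
proof (rule cyclic[OF jacobi_right_in_op_space[OF assms]])
  show "leading ?N k ([:1, 1:] ^ k)"
    using leading_prod_first_order[of "[:1, 1:]" "\<lambda>j. complex_of_real (\<beta>2 + real j)" "rev [1..<k + 1]"]
    by (simp del: upt_Suc)
next
  fix T m f
  assume "T \<in> \<D>(jacobi_weight \<alpha>1 \<beta>1, jacobi_weight \<alpha>2 \<beta>2)" "leading T m f" "f \<noteq> 0"
  from jacobi_leading[OF this] obtain a b c where
    f: "f = smult c ([:-1, 1:] ^ a * [:1, 1:] ^ b)" and m: "m = a + b" and ab: "\<alpha>2 - \<alpha>1 = real b - real a"
    by blast
  have "real b = real (a + k)" using ab assms by simp
  hence b: "b = a + k" by (simp only: of_nat_eq_iff)
  have "f = smult (c * (-1) ^ a) ([:1, 1:] ^ k * [:1, 0, -1:] ^ a)"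
  proof -
    have eq: "([:-1, 1:] :: complex poly) ^ a * [:1, 1:] ^ (a + k) = [:1, 1:] ^ k * ([:-1, 1:] ^ a * [:1, 1:] ^ a)"
      by (simp only: power_add mult_ac)
    show ?thesis unfolding f b one_minus_square_power_eq
      by (simp only: eq mult_smult_right smult_smult mult.assoc minus_one_mult_self mult_1_right)
  qed
  moreover have "m = k + 2 * a" using m b by simp
  ultimately show "\<exists>r c. m = k + 2 * r \<and> f = smult c ([:1, 1:] ^ k * [:1, 0, -1:] ^ r)"
    by blast
qed

lemma jacobi_left_cyclic:
  assumes "\<alpha>1 = \<alpha>2 + real k"
  shows "\<D>(jacobi_weight \<alpha>1 \<beta>1, jacobi_weight \<alpha>2 \<beta>2) =
    (\<lambda>S. prod_list (map (\<lambda>j. first_order [:-1, 1:] (complex_of_real (\<alpha>2 + real j))) (rev [1..<k + 1])) * S)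
      ` \<D>(jacobi_weight \<alpha>2 \<beta>2)"
    (is "_ = (\<lambda>S. ?N * S) ` _")
proof (rule cyclic[OF jacobi_left_in_op_space[OF assms]])
  show "leading ?N k ([:-1, 1:] ^ k)"
    using leading_prod_first_order[of "[:-1, 1:]" "\<lambda>j. complex_of_real (\<alpha>2 + real j)" "rev [1..<k + 1]"]
    by (simp del: upt_Suc)
next
  fix T m f
  assume "T \<in> \<D>(jacobi_weight \<alpha>1 \<beta>1, jacobi_weight \<alpha>2 \<beta>2)" "leading T m f" "f \<noteq> 0"
  from jacobi_leading[OF this] obtain a b c where
    f: "f = smult c ([:-1, 1:] ^ a * [:1, 1:] ^ b)" and m: "m = a + b" and ab: "\<alpha>2 - \<alpha>1 = real b - real a"
    by blast
  have "real a = real (b + k)" using ab assms by simp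
  hence a: "a = b + k" by (simp only: of_nat_eq_iff)
  have "f = smult (c * (-1) ^ b) ([:-1, 1:] ^ k * [:1, 0, -1:] ^ b)"
  proof -
    have eq: "([:-1, 1:] :: complex poly) ^ (b + k) * [:1, 1:] ^ b = [:-1, 1:] ^ k * ([:-1, 1:] ^ b * [:1, 1:] ^ b)"
      by (simp only: power_add mult_ac)
    show ?thesis unfolding f a one_minus_square_power_eq
      by (simp only: eq mult_smult_right smult_smult mult.assoc minus_one_mult_self mult_1_right)
  qed
  moreover have "m = k + 2 * b" using m a by simp
  ultimately show "\<exists>r c. m = k + 2 * r \<and> f = smult c ([:-1, 1:] ^ k * [:1, 0, -1:] ^ r)"
    by blast
qed

lemma jacobi_op_space_zero:
  assumes "\<alpha>1 \<noteq> \<alpha>2" "\<And>k. k \<ge> 1 \<Longrightarrow> \<alpha>2 \<noteq> \<alpha>1 + real k" "\<And>k. k \<ge> 1 \<Longrightarrow> \<alpha>1 \<noteq> \<alpha>2 + real k"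
    and T: "T \<in> \<D>(jacobi_weight \<alpha>1 \<beta>1, jacobi_weight \<alpha>2 \<beta>2)"
  shows "T = 0"
proof (rule ccontr)
  assume "T \<noteq> 0"
  then obtain m f where f: "leading T m f" "f \<noteq> 0"
    using leading_exists by blast
  from jacobi_leading[OF T f] obtain a b where ab: "\<alpha>2 - \<alpha>1 = real b - real a" by blast
  show False
  proof (cases a b rule: linorder_cases)
    case less
    hence "\<alpha>2 = \<alpha>1 + real (b - a)" using ab by (simp add: of_nat_diff)
    moreover have "b - a \<ge> 1" using less by linarith
    ultimately show False using assms(2) by blast
  next
    case equal
    with ab assms(1) show False by simp
  next
    case greater
    hence "\<alpha>1 = \<alpha>2 + real (a - b)" using ab by (simp add: of_nat_diff)
    moreover have "a - b \<ge> 1" using greater by linarith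
    ultimately show False using assms(3) by blast
  qed
qed

end

lemma jacobi_shift_darboux:
  assumes "\<alpha> > -1" "\<beta> > -1"
  shows "darboux_transformation_of (jacobi_weight \<alpha> (\<beta> + real k)) (jacobi_weight (\<alpha> + real k) \<beta>)"
    "darboux_transformation_of (jacobi_weight (\<alpha> + real k) \<beta>) (jacobi_weight \<alpha> (\<beta> + real k))"
proof -
  have k: "\<alpha> + real k > -1" "\<beta> + real k > -1" "\<alpha> + (\<beta> + real k) = \<alpha> + real k + \<beta>"
    using assms by simp_all
  note right = jacobi_right_in_op_space[OF assms(1) k(2) k(1) assms(2) k(3) refl] degree_preserving_down[OF assms(2)]
  note left = jacobi_left_in_op_space[OF k(1) assms(2) assms(1) k(2) k(3)[symmetric] refl] degree_preserving_down[OF assms(1)]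
  show "darboux_transformation_of (jacobi_weight \<alpha> (\<beta> + real k)) (jacobi_weight (\<alpha> + real k) \<beta>)"
    by (rule darboux_transformationI[OF _ left(1) right(1) left(2) right(2)]) (simp add: interval_simps)
  show "darboux_transformation_of (jacobi_weight (\<alpha> + real k) \<beta>) (jacobi_weight \<alpha> (\<beta> + real k))"
    by (rule darboux_transformationI[OF _ right(1) left(1) right(2) left(2)]) (simp add: interval_simps)
qed

lemma jacobi_generator:
  assumes par: "\<alpha>1 > -1" "\<beta>1 > -1" "\<alpha>2 > -1" "\<beta>2 > -1"
  defines "w1 \<equiv> jacobi_weight \<alpha>1 \<beta>1" and "w2 \<equiv> jacobi_weight \<alpha>2 \<beta>2"
  shows "\<exists>T. \<D>(w1, w2) = (\<lambda>S. T * S) ` \<D>(w2) \<and>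
    (\<not> darboux_transformation_of w1 w2 \<longrightarrow> T = 0) \<and> (\<alpha>1 = \<alpha>2 \<and> \<beta>1 = \<beta>2 \<longrightarrow> T = 1) \<and>
    (\<forall>k\<ge>1. \<alpha>2 = \<alpha>1 + real k \<and> \<beta>1 = \<beta>2 + real k \<longrightarrow>
       T = prod_list (map (\<lambda>j. first_order [:1, 1:] (complex_of_real (\<beta>2 + real j))) (rev [1..<k + 1]))) \<and>
    (\<forall>k\<ge>1. \<alpha>1 = \<alpha>2 + real k \<and> \<beta>2 = \<beta>1 + real k \<longrightarrow>
       T = prod_list (map (\<lambda>j. first_order [:-1, 1:] (complex_of_real (\<alpha>2 + real j))) (rev [1..<k + 1])))"
proof -
  consider (same) "\<alpha>1 = \<alpha>2" "\<beta>1 = \<beta>2"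
    | (right) k where "k \<ge> 1" "\<alpha>2 = \<alpha>1 + real k" "\<alpha>1 + \<beta>1 = \<alpha>2 + \<beta>2" "\<beta>1 = \<beta>2 + real k"
    | (left) k where "k \<ge> 1" "\<alpha>1 = \<alpha>2 + real k" "\<alpha>1 + \<beta>1 = \<alpha>2 + \<beta>2" "\<beta>2 = \<beta>1 + real k"
    | (none) "\<alpha>1 + \<beta>1 = \<alpha>2 + \<beta>2" "\<alpha>1 \<noteq> \<alpha>2" "\<And>k. k \<ge> 1 \<Longrightarrow> \<alpha>2 \<noteq> \<alpha>1 + real k"
        "\<And>k. k \<ge> 1 \<Longrightarrow> \<alpha>1 \<noteq> \<alpha>2 + real k"
    | (sums) "\<alpha>1 + \<beta>1 \<noteq> \<alpha>2 + \<beta>2"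
  proof (cases "\<alpha>1 + \<beta>1 = \<alpha>2 + \<beta>2")
    case True
    hence "\<beta>1 - \<beta>2 = \<alpha>2 - \<alpha>1" by algebra
    with True that(1-4) show ?thesis
      by (smt (verit, best))
  qed (rule that(5))
  thus ?thesis
  proof cases
    case same
    hence "w1 = w2" by (simp add: w1_def w2_def)
    thus ?thesis using same darboux_transformation_refl[of w2]
      by (intro exI[of _ 1]) (simp del: upt_Suc)
  next
    case right
    thus ?thesis using jacobi_right_cyclic[OF par right(3,2)] jacobi_shift_darboux(1)[OF par(1,4), of k]
      by (intro exI[of _ "prod_list (map (\<lambda>j. first_order [:1, 1:] (complex_of_real (\<beta>2 + real j))) (rev [1..<k + 1]))"])
         (auto simp: w1_def w2_def simp del: upt_Suc)
  next
    case left
    thus ?thesis using jacobi_left_cyclic[OF par left(3,2)] jacobi_shift_darboux(2)[OF par(3,2), of k]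
      by (intro exI[of _ "prod_list (map (\<lambda>j. first_order [:-1, 1:] (complex_of_real (\<alpha>2 + real j))) (rev [1..<k + 1]))"])
         (auto simp: w1_def w2_def simp del: upt_Suc)
  next
    case none
    have "\<D>(w1, w2) = (\<lambda>S. 0 * S) ` \<D>(w2)"
      unfolding w1_def w2_def by (rule op_space_cyclic_zero) (rule jacobi_op_space_zero[OF par none])
    thus ?thesis using none by (intro exI[of _ 0]) blast
  next
    case sums
    have "\<D>(w1, w2) = (\<lambda>S. 0 * S) ` \<D>(w2)"
      unfolding w1_def w2_def
      by (rule op_space_cyclic_zero) (rule jacobi_op_space_zero_if_sums_differ[OF par sums])
    thus ?thesis using sums by (intro exI[of _ 0]) auto
  qed
qed

section \<open>Parameters are determined by the weight\<close>

lemma laguerre_weight_inject: "laguerre_weight \<alpha> = laguerre_weight \<alpha>' \<longleftrightarrow> \<alpha> = \<alpha>'"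
proof
  assume "laguerre_weight \<alpha> = laguerre_weight \<alpha>'"
  hence "weight.density (laguerre_weight \<alpha>) 2 = weight.density (laguerre_weight \<alpha>') 2"
    by simp
  thus "\<alpha> = \<alpha>'" by (simp add: laguerre_weight_def powr_inj)
qed simp

lemma jacobi_weight_inject: "jacobi_weight \<alpha> \<beta> = jacobi_weight \<alpha>' \<beta>' \<longleftrightarrow> \<alpha> = \<alpha>' \<and> \<beta> = \<beta>'"
proof
  assume eq: "jacobi_weight \<alpha> \<beta> = jacobi_weight \<alpha>' \<beta>'"
  \<comment> \<open>The logarithms of the densities at \<open>\<plusminus>1/2\<close> are linear in the parameters, with an invertible matrix.\<close>
  let ?l = "ln (1 / 2 :: real)" and ?u = "ln (3 / 2 :: real)"
  have ln_density: "ln (weight.density (jacobi_weight \<alpha> \<beta>) (1 / 2)) = \<alpha> * ?l + \<beta> * ?u"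
    "ln (weight.density (jacobi_weight \<alpha> \<beta>) (- 1 / 2)) = \<alpha> * ?u + \<beta> * ?l" for \<alpha> \<beta>
    by (simp_all add: jacobi_weight_def ln_mult ln_powr)
  have "\<alpha> * ?l + \<beta> * ?u = \<alpha>' * ?l + \<beta>' * ?u" "\<alpha> * ?u + \<beta> * ?l = \<alpha>' * ?u + \<beta>' * ?l"
    by (simp_all only: ln_density[symmetric] eq)
  hence 1: "(\<alpha> - \<alpha>') * ?l + (\<beta> - \<beta>') * ?u = 0" and 2: "(\<alpha> - \<alpha>') * ?u + (\<beta> - \<beta>') * ?l = 0"
    by algebra+
  have l: "?l < 0" "?u > 0" by simp_all
  have lu: "?l + ?u < 0"
  proof -
    have "ln (1 / 2 * (3 / 2) :: real) = ?l + ?u"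
      by (rule ln_mult_pos) simp_all
    moreover have "ln (1 / 2 * (3 / 2) :: real) < 0"
      by simp
    ultimately show ?thesis by simp
  qed
  have "(\<alpha> - \<alpha>' + (\<beta> - \<beta>')) * (?l + ?u) = 0"
    using 1 2 by algebra
  hence s: "\<alpha> - \<alpha>' = - (\<beta> - \<beta>')" using lu by simp
  have "(\<alpha> - \<alpha>') * (?l - ?u) = 0"
    using 1 s by algebra
  thus "\<alpha> = \<alpha>' \<and> \<beta> = \<beta>'" using l s by simp
qed simp

lemma weight_types_distinct:
  "hermite_weight b \<noteq> laguerre_weight \<alpha>" "hermite_weight b \<noteq> jacobi_weight \<alpha> \<beta>"
  "laguerre_weight \<alpha> \<noteq> jacobi_weight \<gamma> \<beta>"
proof -
  have "interval (hermite_weight b) \<noteq> interval (laguerre_weight \<alpha>)"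
    "interval (hermite_weight b) \<noteq> interval (jacobi_weight \<alpha> \<beta>)"
    "interval (laguerre_weight \<alpha>) \<noteq> interval (jacobi_weight \<gamma> \<beta>)"
    unfolding interval_simps
    by (metis UNIV_I greaterThan_iff less_irrefl,
        metis UNIV_I greaterThanLessThan_iff less_irrefl,
        metis greaterThan_iff greaterThanLessThan_iff less_irrefl zero_less_one)
  thus "hermite_weight b \<noteq> laguerre_weight \<alpha>" "hermite_weight b \<noteq> jacobi_weight \<alpha> \<beta>"
    "laguerre_weight \<alpha> \<noteq> jacobi_weight \<gamma> \<beta>"
    by auto
qed

section \<open>The generator of each module\<close>

text \<open>
  All requirements on the generator for one fixed pair of weights. Stating them pairwise lets the generators
  be chosen independently; since a weight determines its parameters, at most one of the explicit formulas
  applies to a pair.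
\<close>

definition prescribed_generator :: "diff_op \<Rightarrow> weight \<Rightarrow> weight \<Rightarrow> bool" where
  "prescribed_generator T w1 w2 \<longleftrightarrow> \<D>(w1, w2) = (\<lambda>S. T * S) ` \<D>(w2) \<and>
     (\<not> darboux_transformation_of w1 w2 \<longrightarrow> T = 0) \<and> (w1 = w2 \<longrightarrow> T = 1) \<and>
     (\<forall>\<alpha> k. \<alpha> > -1 \<and> k \<ge> 1 \<longrightarrow>
       (w1 = laguerre_weight \<alpha> \<and> w2 = laguerre_weight (\<alpha> + real k) \<longrightarrow> T = (\<partial> - 1) ^ k) \<and>
       (w1 = laguerre_weight (\<alpha> + real k) \<and> w2 = laguerre_weight \<alpha> \<longrightarrow>
         T = prod_list (map (\<lambda>j. first_order [:0, 1:] (complex_of_real (\<alpha> + real j))) (rev [1..<k + 1])))) \<and>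
     (\<forall>\<alpha> \<beta> k. \<alpha> > -1 \<and> \<beta> > -1 \<and> k \<ge> 1 \<longrightarrow>
       (w1 = jacobi_weight \<alpha> (\<beta> + real k) \<and> w2 = jacobi_weight (\<alpha> + real k) \<beta> \<longrightarrow>
         T = prod_list (map (\<lambda>j. first_order [:1, 1:] (complex_of_real (\<beta> + real j))) (rev [1..<k + 1]))) \<and>
       (w1 = jacobi_weight (\<alpha> + real k) \<beta> \<and> w2 = jacobi_weight \<alpha> (\<beta> + real k) \<longrightarrow>
         T = prod_list (map (\<lambda>j. first_order [:-1, 1:] (complex_of_real (\<alpha> + real j))) (rev [1..<k + 1]))))"

lemma generator_exists:
  assumes "same_type_classical w1 w2"
  shows "\<exists>T. prescribed_generator T w1 w2"
  using assms unfolding same_type_classical_def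
proof (elim disjE exE conjE)
  fix b1 b2 assume w: "w1 = hermite_weight b1" "w2 = hermite_weight b2"
  show ?thesis
  proof (cases "w1 = w2")
    case True
    hence "prescribed_generator 1 w1 w2"
      using darboux_transformation_refl[of w2]
      by (simp add: prescribed_generator_def w weight_types_distinct)
    thus ?thesis ..
  next
    case False
    hence "b1 \<noteq> b2" using w by auto
    have "\<D>(w1, w2) = (\<lambda>S. 0 * S) ` \<D>(w2)"
      unfolding w by (rule op_space_cyclic_zero) (rule hermite_op_space_zero[OF \<open>b1 \<noteq> b2\<close>])
    hence "prescribed_generator 0 w1 w2"
      using False unfolding prescribed_generator_def w by (auto simp: weight_types_distinct)
    thus ?thesis ..
  qed
next
  fix \<alpha>1 \<alpha>2 assume par: "\<alpha>1 > -1" "\<alpha>2 > -1" and w: "w1 = laguerre_weight \<alpha>1" "w2 = laguerre_weight \<alpha>2"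
  from laguerre_generator[OF par] show ?thesis
    unfolding prescribed_generator_def w laguerre_weight_inject
    by (elim exE, intro exI) (auto simp: weight_types_distinct simp del: upt_Suc)
next
  fix \<alpha>1 \<beta>1 \<alpha>2 \<beta>2 assume par: "\<alpha>1 > -1" "\<beta>1 > -1" "\<alpha>2 > -1" "\<beta>2 > -1"
    and w: "w1 = jacobi_weight \<alpha>1 \<beta>1" "w2 = jacobi_weight \<alpha>2 \<beta>2"
  from jacobi_generator[OF par] obtain T where T:
    "\<D>(w1, w2) = (\<lambda>S. T * S) ` \<D>(w2)" "\<not> darboux_transformation_of w1 w2 \<longrightarrow> T = 0"
    "\<alpha>1 = \<alpha>2 \<and> \<beta>1 = \<beta>2 \<longrightarrow> T = 1"
    "\<And>k. k \<ge> 1 \<Longrightarrow> \<alpha>2 = \<alpha>1 + real k \<and> \<beta>1 = \<beta>2 + real k \<Longrightarrow>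
       T = prod_list (map (\<lambda>j. first_order [:1, 1:] (complex_of_real (\<beta>2 + real j))) (rev [1..<k + 1]))"
    "\<And>k. k \<ge> 1 \<Longrightarrow> \<alpha>1 = \<alpha>2 + real k \<and> \<beta>2 = \<beta>1 + real k \<Longrightarrow>
       T = prod_list (map (\<lambda>j. first_order [:-1, 1:] (complex_of_real (\<alpha>2 + real j))) (rev [1..<k + 1]))"
    unfolding w by blast
  have "prescribed_generator T w1 w2"
    unfolding prescribed_generator_def
  proof (intro conjI)
    show "w1 = w2 \<longrightarrow> T = 1" using T(3) by (simp only: w jacobi_weight_inject)
  next
    show "\<forall>\<alpha> \<beta> k. \<alpha> > -1 \<and> \<beta> > -1 \<and> k \<ge> 1 \<longrightarrow>
       (w1 = jacobi_weight \<alpha> (\<beta> + real k) \<and> w2 = jacobi_weight (\<alpha> + real k) \<beta> \<longrightarrow>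
         T = prod_list (map (\<lambda>j. first_order [:1, 1:] (complex_of_real (\<beta> + real j))) (rev [1..<k + 1]))) \<and>
       (w1 = jacobi_weight (\<alpha> + real k) \<beta> \<and> w2 = jacobi_weight \<alpha> (\<beta> + real k) \<longrightarrow>
         T = prod_list (map (\<lambda>j. first_order [:-1, 1:] (complex_of_real (\<alpha> + real j))) (rev [1..<k + 1])))"
      using T(4,5) unfolding w jacobi_weight_inject by blast
  qed (use T(1,2) in \<open>simp_all add: w weight_types_distinct[symmetric]\<close>)
  thus ?thesis ..
qed

theorem theorem6p6:
  shows "\<exists>\<T> :: weight \<Rightarrow> weight \<Rightarrow> diff_op.
    (\<forall>w1 w2. same_type_classical w1 w2 \<longrightarrow> \<D>(w1, w2) = (\<lambda>S. \<T> w1 w2 * S) ` \<D>(w2)) \<and>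
    (\<forall>w1 w2. same_type_classical w1 w2 \<and> \<not> darboux_transformation_of w1 w2 \<longrightarrow> \<T> w1 w2 = 0) \<and>
    (\<forall>w1 w2. same_type_classical w1 w2 \<and> w1 = w2 \<longrightarrow> \<T> w1 w2 = 1) \<and>
    (\<forall>(\<alpha>::real) (k::nat). \<alpha> > -1 \<and> k \<ge> 1 \<longrightarrow>
       \<T> (laguerre_weight \<alpha>) (laguerre_weight (\<alpha> + real k)) = (\<partial> - 1) ^ k \<and>
       \<T> (laguerre_weight (\<alpha> + real k)) (laguerre_weight \<alpha>) =
         prod_list (map (\<lambda>j. \<partial> * mult_op [:0, 1:] + mult_op [:complex_of_real (\<alpha> + real j):])
           (rev [1..<k + 1]))) \<and>
    (\<forall>(\<alpha>::real) (\<beta>::real) (k::nat). \<alpha> > -1 \<and> \<beta> > -1 \<and> k \<ge> 1 \<longrightarrow>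
       \<T> (jacobi_weight \<alpha> (\<beta> + real k)) (jacobi_weight (\<alpha> + real k) \<beta>) =
         prod_list (map (\<lambda>j. \<partial> * mult_op [:1, 1:] + mult_op [:complex_of_real (\<beta> + real j):])
           (rev [1..<k + 1])) \<and>
       \<T> (jacobi_weight (\<alpha> + real k) \<beta>) (jacobi_weight \<alpha> (\<beta> + real k)) =
         prod_list (map (\<lambda>j. \<partial> * mult_op [:-1, 1:] + mult_op [:complex_of_real (\<alpha> + real j):])
           (rev [1..<k + 1])))"
proof -
  have "\<forall>w1 w2. \<exists>T. same_type_classical w1 w2 \<longrightarrow> prescribed_generator T w1 w2"
    using generator_exists by blast
  then obtain \<T> where \<T>: "same_type_classical w1 w2 \<Longrightarrow> prescribed_generator (\<T> w1 w2) w1 w2" for w1 w2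
    by metis
  have laguerre: "prescribed_generator (\<T> (laguerre_weight \<alpha>) (laguerre_weight \<beta>)) (laguerre_weight \<alpha>) (laguerre_weight \<beta>)"
    if "\<alpha> > -1" "\<beta> > -1" for \<alpha> \<beta>
    using that by (intro \<T>) (auto simp: same_type_classical_def)
  have jacobi: "prescribed_generator (\<T> (jacobi_weight \<alpha> \<beta>) (jacobi_weight \<gamma> \<delta>)) (jacobi_weight \<alpha> \<beta>) (jacobi_weight \<gamma> \<delta>)"
    if "\<alpha> > -1" "\<beta> > -1" "\<gamma> > -1" "\<delta> > -1" for \<alpha> \<beta> \<gamma> \<delta>
    unfolding same_type_classical_def using that by (intro \<T>) (unfold same_type_classical_def, blast)
  show ?thesis
    unfolding first_order_def[symmetric]
  proof (intro exI[of _ \<T>] conjI allI impI; (elim conjE)?)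
    fix w1 w2 assume w: "same_type_classical w1 w2"
    show "\<D>(w1, w2) = (\<lambda>S. \<T> w1 w2 * S) ` \<D>(w2)"
      using \<T>[OF w] unfolding prescribed_generator_def by blast
  next
    fix w1 w2 assume w: "same_type_classical w1 w2" and "\<not> darboux_transformation_of w1 w2"
    thus "\<T> w1 w2 = 0"
      using \<T>[OF w] unfolding prescribed_generator_def by blast
  next
    fix w1 w2 assume w: "same_type_classical w1 w2" and "w1 = w2"
    thus "\<T> w1 w2 = 1"
      using \<T>[OF w] unfolding prescribed_generator_def by blast
  next
    fix \<alpha> :: real and k :: nat assume \<alpha>: "\<alpha> > -1" and k: "k \<ge> 1"
    hence "\<alpha> + real k > -1" by simp
    from laguerre[OF \<alpha> this] \<alpha> k
    show "\<T> (laguerre_weight \<alpha>) (laguerre_weight (\<alpha> + real k)) = (\<partial> - 1) ^ k"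
      unfolding prescribed_generator_def by blast
  next
    fix \<alpha> :: real and k :: nat assume \<alpha>: "\<alpha> > -1" and k: "k \<ge> 1"
    hence "\<alpha> + real k > -1" by simp
    from laguerre[OF this \<alpha>] \<alpha> k
    show "\<T> (laguerre_weight (\<alpha> + real k)) (laguerre_weight \<alpha>) =
        prod_list (map (\<lambda>j. first_order [:0, 1:] (complex_of_real (\<alpha> + real j))) (rev [1..<k + 1]))"
      unfolding prescribed_generator_def by blast
  next
    fix \<alpha> \<beta> :: real and k :: nat assume \<alpha>: "\<alpha> > -1" and \<beta>: "\<beta> > -1" and k: "k \<ge> 1"
    hence "\<alpha> + real k > -1" "\<beta> + real k > -1" by simp_all
    from jacobi[OF \<alpha> this(2) this(1) \<beta>] \<alpha> \<beta> k
    show "\<T> (jacobi_weight \<alpha> (\<beta> + real k)) (jacobi_weight (\<alpha> + real k) \<beta>) =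
        prod_list (map (\<lambda>j. first_order [:1, 1:] (complex_of_real (\<beta> + real j))) (rev [1..<k + 1]))"
      unfolding prescribed_generator_def by blast
  next
    fix \<alpha> \<beta> :: real and k :: nat assume \<alpha>: "\<alpha> > -1" and \<beta>: "\<beta> > -1" and k: "k \<ge> 1"
    hence "\<alpha> + real k > -1" "\<beta> + real k > -1" by simp_all
    from jacobi[OF this(1) \<beta> \<alpha> this(2)] \<alpha> \<beta> k
    show "\<T> (jacobi_weight (\<alpha> + real k) \<beta>) (jacobi_weight \<alpha> (\<beta> + real k)) =
        prod_list (map (\<lambda>j. first_order [:-1, 1:] (complex_of_real (\<alpha> + real j))) (rev [1..<k + 1]))"
      unfolding prescribed_generator_def by blast
  qed
qed

end
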